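(* Let $q=3^h$, $h\ge2$, and let $$F(u)=a+\gamma\psi(u)+\overline\gamma\psi(-u)\quad(u\in\mathbb F_q),\qquad a\in\mathbb R,\quad\gamma=x+iy\ \ (x,y\in\mathbb R),$$ where $\psi(u)=\exp(2\pi i\operatorname{Tr}_{\mathbb F_q/\mathbb F_3}(u)/3)$. Assume $F\not\equiv0$. Define $$\begin{gathered}e=x^2+y^2,\quad b=2(x^2-y^2),\quad c=2ax,\quad n=q-3,\\ N=q(a^2+2e)-(a+2x)^2,\qquad Q=(a+2x)^4,\\ V=(a^2+b)^2+2(e+c)^2,\quad W=a^4+2e^2,\quad Z=a^2(a^2+b)+2e(e+c),\\ L_1=b+2c,\quad L_2=4y(x-a),\quad L_3=b-c,\quad L_4=2y(2x+a),\end{gathered}$$ and normalize the restriction of $F$ to $\mathbb F_q^\times$ as the unit vector $\phi=F/\sqrt N$. Let $\mu_-$ be the smaller eigenvalue of $$K=\frac1{N^2}\begin{pmatrix}qV-Q&\sqrt n\,(qZ-Q)\\ \sqrt n\,(qZ-Q)&q(L_1^2+nW)-nQ\end{pmatrix}.$$ Then $$\sigma_{\min}(\mathcal M_\phi)^2=q\min\left\{\frac q{N^2}\min_{1\le j\le4}L_j^2,\ \mu_-\right\}.$$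
   Context: $G_q=\mathbb F_q\rtimes\mathbb F_q^\times$ is the affine group with product $(k,l)(k',l')=(k+lk',ll')$, acting on $\mathbb C^{\mathbb F_q^\times}$ by the unitary representation $(\pi_q(k,l)f)(m)=\psi_0(km)f(lm)$, where $\psi_0$ is any fixed nontrivial additive character of $\mathbb F_q$. For a vector $\phi$, $\mathcal M_\phi:\mathbb C^{\mathbb F_q^\times\times\mathbb F_q^\times}\to\mathbb C^{G_q}$ is the linear map $\mathcal M_\phi(A)(g)=\langle A\pi_q(g)\phi,\pi_q(g)\phi\rangle$, and $\sigma_{\min}(\mathcal M_\phi)=\min_{A\ne0}\|\mathcal M_\phi(A)\|_{\ell^2(G_q)}/\|A\|_F$ (Frobenius norm; counting measure on $G_q$). The functions $F$ of the displayed form are exactly the real functions on $\mathbb F_q$ that are constant on the three classes of $\operatorname{Tr}_{\mathbb F_q/\mathbb F_3}$. *)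

theory Defs
  imports
    "HOL-Analysis.L2_Norm"
    "HOL-Library.Cardinality"
    "HOL-Number_Theory.Residues"
    "Jordan_Normal_Form.Char_Poly"
begin

subsection \<open>Characters and the trace to the prime field\<close>

definition nontrivial_additive_character :: "('a::field \<Rightarrow> complex) \<Rightarrow> bool" where
  "nontrivial_additive_character \<chi> \<longleftrightarrow>
     (\<forall>u. cmod (\<chi> u) = 1) \<and> (\<forall>u v. \<chi> (u + v) = \<chi> u * \<chi> v) \<and> (\<exists>u. \<chi> u \<noteq> 1)"

text \<open>
  For a field with \<open>3 ^ h\<close> elements this is the trace to its prime field, as the sum over the
  powers of the Frobenius map. Its values are elements of the large field.
\<close>

definition trace3 :: "nat \<Rightarrow> 'a::field \<Rightarrow> 'a" where
  "trace3 h u = (\<Sum>i<h. u ^ (3 ^ i))"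

text \<open>The representative in \<open>{0, 1, 2}\<close> of an element of the prime field of order 3.\<close>

definition lift3 :: "'a::field \<Rightarrow> nat" where
  "lift3 z = (THE k. k < 3 \<and> of_nat k = z)"

definition trace_character :: "nat \<Rightarrow> 'a::field \<Rightarrow> complex" where
  "trace_character h u = exp (2 * of_real pi * \<i> * of_nat (lift3 (trace3 h u)) / 3)"

lemma lift3_trace3:
  fixes u :: "'a::finite_field"
  assumes "CARD('a) = 3 ^ h"
  shows "lift3 (trace3 h u) < 3 \<and> of_nat (lift3 (trace3 h u)) = trace3 h u"
proof -
  have "CHAR('a) dvd 3 ^ h"
    using CHAR_dvd_CARD[where ?'a = 'a] assms by simp
  then have "CHAR('a) dvd 3"
    using prime_dvd_power[of "CHAR('a)" 3 h] by simp
  then have char: "CHAR('a) = 3"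
    using primes_dvd_imp_eq[of "CHAR('a)" 3] by simp
  have three: "(3::'a) = 0"
    using of_nat_CHAR[where ?'a = 'a] by (simp add: char)
  have inj: "j = k" if "j < 3" "k < 3" "(of_nat j :: 'a) = of_nat k" for j k :: nat
    using that of_nat_eq_iff_cong_CHAR[of j k, where ?'a = 'a] by (simp add: char cong_def)
  have frob: "(v + w) ^ 3 = v ^ 3 + w ^ 3" for v w :: 'a
    by (rule freshmans_dream) (simp_all add: char)
  have "trace3 k u ^ 3 = (\<Sum>i<k. u ^ (3 ^ Suc i))" for k
  proof (induction k)
    case (Suc k)
    have "trace3 (Suc k) u ^ 3 = trace3 k u ^ 3 + (u ^ (3 ^ k)) ^ 3"
      by (simp add: trace3_def frob)
    also have "(u ^ (3 ^ k)) ^ 3 = u ^ (3 ^ Suc k)"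
      by (simp add: power_mult[symmetric] mult.commute)
    finally show ?case using Suc by simp
  qed (simp add: trace3_def)
  moreover have "(\<Sum>i<h. u ^ (3 ^ Suc i)) + u ^ (3 ^ 0) = trace3 h u + u ^ (3 ^ h)"
    using sum.lessThan_Suc_shift[of "\<lambda>i. u ^ (3 ^ i)" h]
    by (simp add: trace3_def add.commute)
  moreover have "u ^ (3 ^ h) = u"
    using finite_field_power_card_eq_same[of u] assms by simp
  ultimately have "trace3 h u ^ 3 = trace3 h u" by simp
  then have "trace3 h u * (trace3 h u - 1) * (trace3 h u - 2) = 0"
  proof -
    have "trace3 h u * (trace3 h u - 1) * (trace3 h u - 2)
        = trace3 h u ^ 3 - trace3 h u - 3 * (trace3 h u ^ 2 - trace3 h u)"
      by (simp add: algebra_simps power2_eq_square power3_eq_cube)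
    then show ?thesis using \<open>trace3 h u ^ 3 = trace3 h u\<close> three by simp
  qed
  then consider "trace3 h u = of_nat 0" | "trace3 h u = of_nat 1" | "trace3 h u = of_nat 2"
    by force
  then have "\<exists>k<3. of_nat k = trace3 h u"
  proof cases
    case 1
    then show ?thesis by (intro exI[of _ 0]) simp
  next
    case 2
    then show ?thesis by (intro exI[of _ 1]) simp
  next
    case 3
    then show ?thesis by (intro exI[of _ 2]) simp
  qed
  then obtain k where k: "k < 3" "of_nat k = trace3 h u"
    by auto
  have "\<exists>!k. k < 3 \<and> of_nat k = trace3 h u"
    by (rule ex1I[of _ k]) (use k in \<open>auto intro!: inj\<close>)
  then show ?thesis
    unfolding lift3_def by (rule theI')
qed


subsection \<open>The affine group and its representation\<close>

definition affine_group :: "('a::field \<times> 'a) monoid" where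
  "affine_group =
     \<lparr>carrier = UNIV \<times> (UNIV - {0}),
      monoid.mult = (\<lambda>(k, l) (k', l'). (k + l * k', l * l')),
      one = (0, 1)\<rparr>"

text \<open>
  Vectors on the nonzero field elements are functions on the whole field, and matrices are
  functions of two field elements; only their values at nonzero arguments are ever used.
\<close>

definition affine_rep ::
    "('a::field \<Rightarrow> complex) \<Rightarrow> 'a \<times> 'a \<Rightarrow> ('a \<Rightarrow> complex) \<Rightarrow> 'a \<Rightarrow> complex" where
  "affine_rep \<psi>0 g f m = (case g of (k, l) \<Rightarrow> \<psi>0 (k * m) * f (l * m))"

definition inner_units :: "('a::field \<Rightarrow> complex) \<Rightarrow> ('a \<Rightarrow> complex) \<Rightarrow> complex" where
  "inner_units f f' = (\<Sum>m\<in>UNIV - {0}. f m * cnj (f' m))"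

definition apply_units :: "('a::field \<Rightarrow> 'a \<Rightarrow> complex) \<Rightarrow> ('a \<Rightarrow> complex) \<Rightarrow> 'a \<Rightarrow> complex" where
  "apply_units A f m = (\<Sum>m'\<in>UNIV - {0}. A m m' * f m')"

definition measurement_map ::
    "('a::field \<Rightarrow> complex) \<Rightarrow> ('a \<Rightarrow> complex) \<Rightarrow> ('a \<Rightarrow> 'a \<Rightarrow> complex) \<Rightarrow> 'a \<times> 'a \<Rightarrow> complex" where
  "measurement_map \<psi>0 \<phi> A g =
     inner_units (apply_units A (affine_rep \<psi>0 g \<phi>)) (affine_rep \<psi>0 g \<phi>)"

definition frobenius_norm_units :: "('a::field \<Rightarrow> 'a \<Rightarrow> complex) \<Rightarrow> real" where
  "frobenius_norm_units A = L2_set (\<lambda>(m, m'). cmod (A m m')) ((UNIV - {0}) \<times> (UNIV - {0}))"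

text \<open>
  \<open>LEAST\<close> over the reals is the minimum: it is only determined if the minimum is attained.
\<close>

definition sigma_min :: "('a::field \<Rightarrow> complex) \<Rightarrow> ('a \<Rightarrow> complex) \<Rightarrow> real" where
  "sigma_min \<psi>0 \<phi> =
     (LEAST r. \<exists>A. (\<exists>m m'. m \<noteq> 0 \<and> m' \<noteq> 0 \<and> A m m' \<noteq> 0) \<and>
        r = L2_set (\<lambda>g. cmod (measurement_map \<psi>0 \<phi> A g)) (carrier affine_group)
              / frobenius_norm_units A)"

end

theory Submission
  imports Defs
begin

text \<open>
  Parseval in the translation variable splits \<open>\<parallel>M A\<parallel>\<^sup>2\<close> over the differences \<open>d = m' - m\<close>, so the
  problem decouples into one quadratic form for \<open>d = 0\<close> and, after rescaling, one and the same form
  for all \<open>d \<noteq> 0\<close>. In characteristic 3 the pairs of difference \<open>d\<close> are \<open>(d (r + 1), d (r - 1))\<close>, and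
  the value at \<open>t\<close> of the form's inner sum is the Fourier transform at \<open>t\<close> of a combination of the
  even part, the odd part and a point mass at \<open>0\<close>, whose coefficients depend only on whether
  \<open>\<psi> t = 1\<close>. Restricting a Fourier transform to \<open>\<psi> t = 1\<close> amounts to averaging the function over
  the cosets of the prime field, so a second use of Parseval diagonalizes everything: parity and
  coset average versus remainder give the four values \<open>q L\<^sub>j\<^sup>2\<close>, and a point mass at \<open>0\<close> coupled to
  the constants off the prime field gives the matrix \<open>K\<close>. The form for \<open>d = 0\<close> has the eigenvalues
  \<open>q L\<^sub>1\<^sup>2\<close>, \<open>q L\<^sub>2\<^sup>2\<close> and, on constants, \<open>N\<^sup>2\<close>, which is at least \<open>q L\<^sub>2\<^sup>2\<close>. For \<open>q = 9\<close> the
  eigenvalue \<open>q L\<^sub>1\<^sup>2\<close> comes from \<open>d = 0\<close> only.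
\<close>

section \<open>Fourier analysis on a finite field\<close>

lemma nontrivial_additive_characterD:
  assumes "nontrivial_additive_character \<chi>"
  shows additive_character_add: "\<chi> (u + v) = \<chi> u * \<chi> v"
    and additive_character_zero: "\<chi> 0 = 1"
    and additive_character_uminus: "\<chi> (- u) = cnj (\<chi> u)"
proof -
  have add: "\<chi> (u + v) = \<chi> u * \<chi> v" and norm: "cmod (\<chi> u) = 1" for u v
    using assms by (auto simp: nontrivial_additive_character_def)
  have "\<chi> 0 * \<chi> 0 = \<chi> 0" "\<chi> 0 \<noteq> 0"
    using add[of 0 0] norm[of 0] by auto
  then show zero: "\<chi> 0 = 1" by simp
  have "\<chi> u * \<chi> (- u) = 1"
    using add[of u "- u"] zero by simp
  moreover have "\<chi> u * cnj (\<chi> u) = 1"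
    by (simp add: complex_norm_square[symmetric] norm)
  moreover have "\<chi> u \<noteq> 0"
    using norm[of u] by auto
  ultimately show "\<chi> (- u) = cnj (\<chi> u)"
    by (metis mult_left_cancel)
qed (use assms in \<open>auto simp: nontrivial_additive_character_def\<close>)

lemma sum_additive_character:
  fixes \<chi> :: "'a::finite_field \<Rightarrow> complex"
  assumes "nontrivial_additive_character \<chi>"
  shows "(\<Sum>t\<in>UNIV. \<chi> (t * r)) = (if r = 0 then of_nat CARD('a) else 0)"
proof (cases "r = 0")
  case True
  then show ?thesis by (simp add: additive_character_zero[OF assms])
next
  case False
  obtain u where u: "\<chi> u \<noteq> 1"
    using assms by (auto simp: nontrivial_additive_character_def)
  have "(\<Sum>t\<in>UNIV. \<chi> (t * r)) = (\<Sum>t\<in>UNIV. \<chi> t)"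
    by (rule sum.reindex_bij_witness[of _ "\<lambda>t. t / r" "\<lambda>t. t * r"]) (use False in auto)
  moreover have "(\<Sum>t\<in>UNIV. \<chi> t) = (\<Sum>t\<in>UNIV. \<chi> (u + t))"
    by (rule sum.reindex_bij_witness[of _ "\<lambda>t. u + t" "\<lambda>t. t - u"]) auto
  then have "(\<Sum>t\<in>UNIV. \<chi> t) = \<chi> u * (\<Sum>t\<in>UNIV. \<chi> t)"
    unfolding additive_character_add[OF assms] sum_distrib_left .
  then have "(\<Sum>t\<in>UNIV. \<chi> t) = 0"
    using u by simp
  ultimately show ?thesis using False by simp
qed

text \<open>Unnormalised, so Parseval carries the factor q and a point mass at 0 has a constant
  transform.\<close>

definition dft :: "('a::field \<Rightarrow> complex) \<Rightarrow> ('a \<Rightarrow> complex) \<Rightarrow> 'a \<Rightarrow> complex" where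
  "dft \<chi> G t = (\<Sum>r\<in>UNIV. G r * \<chi> (t * r))"

abbreviation sqnorm :: "('a \<Rightarrow> complex) \<Rightarrow> real" where
  "sqnorm G \<equiv> (\<Sum>r\<in>UNIV. (cmod (G r))\<^sup>2)"

lemma dft_add: "dft \<chi> (\<lambda>r. G r + H r) t = dft \<chi> G t + dft \<chi> H t"
  by (simp add: dft_def distrib_right sum.distrib)

lemma dft_diff: "dft \<chi> (\<lambda>r. G r - H r) t = dft \<chi> G t - dft \<chi> H t"
  by (simp add: dft_def left_diff_distrib sum_subtractf)

lemma parseval:
  fixes \<chi> :: "'a::finite_field \<Rightarrow> complex"
  assumes "nontrivial_additive_character \<chi>"
  shows "sqnorm (dft \<chi> G) = real CARD('a) * sqnorm G"
proof -
  have "complex_of_real (sqnorm (dft \<chi> G)) = (\<Sum>t\<in>UNIV. dft \<chi> G t * cnj (dft \<chi> G t))"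
    by (simp only: of_real_sum complex_norm_square)
  also have "\<dots> = (\<Sum>t\<in>UNIV. \<Sum>r\<in>UNIV. \<Sum>s\<in>UNIV. G r * cnj (G s) * \<chi> (t * (r - s)))"
  proof (rule sum.cong[OF refl])
    fix t
    have "\<chi> (t * (r - s)) = \<chi> (t * r) * cnj (\<chi> (t * s))" for r s
      using additive_character_add[OF assms, of "t * r" "- (t * s)"]
        additive_character_uminus[OF assms, of "t * s"] by (simp add: right_diff_distrib)
    then show "dft \<chi> G t * cnj (dft \<chi> G t)
        = (\<Sum>r\<in>UNIV. \<Sum>s\<in>UNIV. G r * cnj (G s) * \<chi> (t * (r - s)))"
      by (simp add: dft_def sum_product mult_ac)
  qed
  also have "\<dots> = (\<Sum>r\<in>UNIV. \<Sum>t\<in>UNIV. \<Sum>s\<in>UNIV. G r * cnj (G s) * \<chi> (t * (r - s)))"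
    by (rule sum.swap)
  also have "\<dots> = (\<Sum>r\<in>UNIV. \<Sum>s\<in>UNIV. \<Sum>t\<in>UNIV. G r * cnj (G s) * \<chi> (t * (r - s)))"
    by (intro sum.cong refl sum.swap)
  also have "\<dots> = (\<Sum>r\<in>UNIV. \<Sum>s\<in>UNIV. G r * cnj (G s) * (if r = s then of_nat CARD('a) else 0))"
    by (simp add: sum_distrib_left[symmetric] sum_additive_character[OF assms])
  also have "\<dots> = (\<Sum>r\<in>UNIV. G r * cnj (G r) * of_nat CARD('a))"
    by (intro sum.cong refl) (simp add: if_distrib cong: if_cong)
  also have "\<dots> = complex_of_real (real CARD('a) * sqnorm G)"
    by (simp only: of_real_sum of_real_mult complex_norm_square sum_distrib_left of_real_of_nat_eq mult.commute)
  finally show ?thesis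
    by (simp only: of_real_eq_iff)
qed

text \<open>Reflection turns \<open>G + H\<close> into \<open>G - H\<close>, so both have the same
  norm, and the parallelogram law gives the claim.\<close>

lemma sqnorm_even_plus_odd:
  fixes G H :: "'a::{finite,group_add} \<Rightarrow> complex"
  assumes "\<And>r. G (- r) = G r" and "\<And>r. H (- r) = - H r"
  shows "sqnorm (\<lambda>r. G r + H r) = sqnorm G + sqnorm H"
proof -
  have "sqnorm (\<lambda>r. G r + H r) = sqnorm (\<lambda>r. G r - H r)"
    by (rule sum.reindex_bij_witness[of _ uminus uminus]) (auto simp: assms)
  moreover have "sqnorm (\<lambda>r. G r + H r) + sqnorm (\<lambda>r. G r - H r) = 2 * (sqnorm G + sqnorm H)"
    unfolding sum.distrib[symmetric] sum_distrib_left cmod_power2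
    by (intro sum.cong refl) (simp add: power2_eq_square algebra_simps)
  ultimately show ?thesis by simp
qed

lemma sum_uminus_reindex:
  fixes g :: "'a::{finite,group_add} \<Rightarrow> 'b::comm_monoid_add"
  shows "(\<Sum>r\<in>UNIV. g (- r)) = (\<Sum>r\<in>UNIV. g r)"
  by (rule sum.reindex_bij_witness[of _ uminus uminus]) auto

lemma sum_shift_reindex:
  fixes g :: "'a::{finite,group_add} \<Rightarrow> 'b::comm_monoid_add"
  shows "(\<Sum>r\<in>UNIV. g (r + s)) = (\<Sum>r\<in>UNIV. g r)"
  by (rule sum.reindex_bij_witness[of _ "\<lambda>r. r - s" "\<lambda>r. r + s"]) auto

lemma sum_shift_left_reindex:
  fixes g :: "'a::{finite,group_add} \<Rightarrow> 'b::comm_monoid_add"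
  shows "(\<Sum>r\<in>UNIV. g (s + r)) = (\<Sum>r\<in>UNIV. g r)"
  by (rule sum.reindex_bij_witness[of _ "\<lambda>r. - s + r" "\<lambda>r. s + r"]) (auto simp: add.assoc[symmetric])

section \<open>The trace character\<close>

lemma CHAR_eq_3:
  assumes "CARD('a::finite_field) = 3 ^ h"
  shows "CHAR('a) = 3"
proof -
  have "CHAR('a) dvd 3 ^ h"
    using CHAR_dvd_CARD[where ?'a = 'a] assms by simp
  then have "CHAR('a) dvd 3"
    using prime_dvd_power[of "CHAR('a)" 3 h] by simp
  then show ?thesis
    using primes_dvd_imp_eq[of "CHAR('a)" 3] by simp
qed

lemma trace3_add:
  fixes u v :: "'a::finite_field"
  assumes "CARD('a) = 3 ^ h"
  shows "trace3 k (u + v) = trace3 k u + trace3 k v"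
proof -
  have "(u + v) ^ (3 ^ i) = u ^ (3 ^ i) + v ^ (3 ^ i)" for i
    using freshmans_dream'[of "3 ^ i" i u v] CHAR_eq_3[OF assms] by simp
  then show ?thesis by (simp add: trace3_def sum.distrib)
qed

text \<open>As a polynomial in u the trace has linear coefficient 1 (only \<open>i = 0\<close>
  contributes) and degree at most \<open>3 ^ (h - 1)\<close>, less than the order of the field. It
  therefore cannot vanish everywhere.\<close>

lemma trace3_not_zero:
  assumes "CARD('a::finite_field) = 3 ^ h" and "h > 0"
  shows "\<exists>u::'a. trace3 h u \<noteq> 0"
proof (rule ccontr)
  assume "\<not> ?thesis"
  then have zero: "trace3 h u = 0" for u :: 'a by auto
  define p :: "'a poly" where "p = (\<Sum>i<h. monom 1 (3 ^ i))"
  have "coeff p 1 = (\<Sum>i<h. if i = 0 then 1 else 0)"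
    unfolding p_def coeff_sum by (intro sum.cong) auto
  then have "p \<noteq> 0"
    using assms(2) by auto
  have "degree p \<le> 3 ^ (h - 1)"
    unfolding p_def
    by (intro degree_sum_le) (auto intro!: order.trans[OF degree_monom_le] power_increasing)
  also have "\<dots> < CARD('a)"
    using assms by (simp add: power_strict_increasing)
  finally have "degree p < CARD('a)" .
  moreover have "{u. poly p u = 0} = UNIV"
    using zero by (auto simp: p_def poly_sum poly_monom trace3_def)
  ultimately show False
    using card_poly_roots_bound[OF \<open>p \<noteq> 0\<close>] by simp
qed

text \<open>The character is a power of a primitive cube root of unity \<omega>. The exponent
  \<open>lift3\<close> is additive only modulo 3, which is enough because \<omega> has order
  3.\<close>

lemma nontrivial_trace_character:
  assumes "CARD('a::finite_field) = 3 ^ h" and "h > 0"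
  shows "nontrivial_additive_character (trace_character h :: 'a \<Rightarrow> complex)"
proof -
  define \<omega> :: complex where "\<omega> = cis (2 * pi / 3)"
  have cube: "\<omega> ^ 3 = 1"
    by (simp add: \<omega>_def DeMoivre)
  \<comment> \<open>The coordinates are needed at the end, to see that neither \<omega> nor its
    square is 1.\<close>
  have \<omega>: "\<omega> = Complex (- 1 / 2) (sqrt 3 / 2)"
    by (simp add: \<omega>_def cis.ctr cos_120 sin_120)
  have eq: "trace_character h u = \<omega> ^ lift3 (trace3 h u)" for u :: 'a
    by (simp add: trace_character_def \<omega>_def cis_conv_exp exp_of_nat_mult[symmetric] mult_ac)
  note lift = lift3_trace3[OF assms(1)]
  have mod3: "\<omega> ^ k = \<omega> ^ (k mod 3)" for k
  proof -
    have "\<omega> ^ k = \<omega> ^ (3 * (k div 3) + k mod 3)" by simp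
    also have "\<dots> = \<omega> ^ (k mod 3)"
      unfolding power_add power_mult cube by simp
    finally show ?thesis .
  qed
  have add: "trace_character h (u + v) = trace_character h u * trace_character h v" for u v :: 'a
  proof -
    have "(of_nat (lift3 (trace3 h (u + v))) :: 'a) = of_nat (lift3 (trace3 h u) + lift3 (trace3 h v))"
      using lift[of u] lift[of v] lift[of "u + v"] trace3_add[OF assms(1), of h u v] by simp
    then have "lift3 (trace3 h (u + v)) mod 3 = (lift3 (trace3 h u) + lift3 (trace3 h v)) mod 3"
      unfolding of_nat_eq_iff_cong_CHAR CHAR_eq_3[OF assms(1)] cong_def .
    then show ?thesis
      unfolding eq power_add[symmetric] by (metis mod3)
  qed
  obtain u :: 'a where u: "trace3 h u \<noteq> 0"
    using trace3_not_zero[OF assms] by blast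
  then have "lift3 (trace3 h u) = 1 \<or> lift3 (trace3 h u) = 2"
    using lift[of u] by (cases "lift3 (trace3 h u) = 0") auto
  then have "trace_character h u \<noteq> 1"
    unfolding eq by (auto simp: \<omega> power2_eq_square complex_eq_iff)
  moreover have "cmod (trace_character h u) = 1" for u :: 'a
    by (simp add: eq \<omega>_def norm_power)
  ultimately show ?thesis
    using add by (auto simp: nontrivial_additive_character_def)
qed

section \<open>Fibering the measurement map over translations\<close>

text \<open>The form for difference 0. Outer sums omit \<open>t = 0\<close> because the dilation is
  a unit; inner sums run over the whole field because the coefficients will be zero
  extensions.\<close>

definition diagonal_energy :: "('a::finite_field \<Rightarrow> complex) \<Rightarrow> ('a \<Rightarrow> complex) \<Rightarrow> real" where
  "diagonal_energy f D = (\<Sum>t\<in>UNIV - {0}. (cmod (\<Sum>m\<in>UNIV. D m * (f (t * m) * cnj (f (t * m)))))\<^sup>2)"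

text \<open>The form for a difference \<open>d \<noteq> 0\<close>, with \<open>d\<close> already
  absorbed into \<open>t\<close>; the same form serves every such \<open>d\<close>.\<close>

definition translate_energy :: "('a::finite_field \<Rightarrow> complex) \<Rightarrow> ('a \<Rightarrow> complex) \<Rightarrow> real" where
  "translate_energy f C =
     (\<Sum>t\<in>UNIV - {0}. (cmod (\<Sum>r\<in>UNIV. C r * (f (t * (r - 1)) * cnj (f (t * (r + 1))))))\<^sup>2)"

text \<open>Extending by zero lets Parseval and translations act on the full field, and discards the
  values of \<open>A\<close> at zero arguments.\<close>

definition zero_extend :: "('a::field \<Rightarrow> 'a \<Rightarrow> complex) \<Rightarrow> 'a \<Rightarrow> 'a \<Rightarrow> complex" where
  "zero_extend A m m' = (if m = 0 \<or> m' = 0 then 0 else A m m')"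

text \<open>The phases of the two vectors combine to \<open>\<psi>0 (k * (m' - m))\<close>, which
  depends on the difference alone. Grouping the matrix entries by \<open>d = m' - m\<close> thus
  produces a Fourier transform in \<open>k\<close>.\<close>

lemma measurement_map_eq_dft:
  fixes \<psi>0 :: "'a::finite_field \<Rightarrow> complex"
  assumes "nontrivial_additive_character \<psi>0"
  shows "measurement_map \<psi>0 f A (k, l) =
    dft \<psi>0 (\<lambda>d. \<Sum>m\<in>UNIV. zero_extend A m (m + d) * (f (l * (m + d)) * cnj (f (l * m)))) k"
proof -
  have summand: "zero_extend A m m' * (\<psi>0 (k * m') * f (l * m')) * cnj (\<psi>0 (k * m) * f (l * m))
      = zero_extend A m m' * (f (l * m') * cnj (f (l * m))) * \<psi>0 (k * (m' - m))" for m m'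
    using additive_character_add[OF assms, of "k * m'" "- (k * m)"]
      additive_character_uminus[OF assms, of "k * m"] by (simp add: right_diff_distrib)
  have "measurement_map \<psi>0 f A (k, l)
      = (\<Sum>m\<in>UNIV - {0}. \<Sum>m'\<in>UNIV - {0}.
           A m m' * (\<psi>0 (k * m') * f (l * m')) * cnj (\<psi>0 (k * m) * f (l * m)))"
    by (simp add: measurement_map_def inner_units_def apply_units_def affine_rep_def sum_distrib_right)
  also have "\<dots> = (\<Sum>m\<in>UNIV. \<Sum>m'\<in>UNIV.
           zero_extend A m m' * (\<psi>0 (k * m') * f (l * m')) * cnj (\<psi>0 (k * m) * f (l * m)))"
    by (intro sum.mono_neutral_cong_left ballI sum.neutral) (auto simp: zero_extend_def)
  also have "\<dots> = (\<Sum>m\<in>UNIV. \<Sum>d\<in>UNIV.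
      zero_extend A m (m + d) * (f (l * (m + d)) * cnj (f (l * m))) * \<psi>0 (k * d))"
  proof (rule sum.cong[OF refl])
    fix m
    show "(\<Sum>m'\<in>UNIV. zero_extend A m m' * (\<psi>0 (k * m') * f (l * m')) * cnj (\<psi>0 (k * m) * f (l * m)))
      = (\<Sum>d\<in>UNIV. zero_extend A m (m + d) * (f (l * (m + d)) * cnj (f (l * m))) * \<psi>0 (k * d))"
      unfolding summand
      using sum_shift_left_reindex[of "\<lambda>m'. zero_extend A m m' * (f (l * m') * cnj (f (l * m))) * \<psi>0 (k * (m' - m))" m]
      by simp
  qed
  also have "\<dots> = (\<Sum>d\<in>UNIV. \<Sum>m\<in>UNIV.
      zero_extend A m (m + d) * (f (l * (m + d)) * cnj (f (l * m))) * \<psi>0 (k * d))"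
    by (rule sum.swap)
  finally show ?thesis
    by (simp add: dft_def sum_distrib_right)
qed

text \<open>This parametrization turns the reflection \<open>(m, m') \<mapsto> (- m', - m)\<close> into \<open>r \<mapsto> - r\<close>.\<close>

definition fiber :: "('a::field \<Rightarrow> 'a \<Rightarrow> complex) \<Rightarrow> 'a \<Rightarrow> 'a \<Rightarrow> complex" where
  "fiber A d r = zero_extend A (d * (r + 1)) (d * (r - 1))"

text \<open>Since 2 = -1, adding \<open>d\<close> to \<open>d * (r + 1)\<close> gives
  \<open>d * (r - 1)\<close>. The midpoint of the pair is \<open>d * r\<close>, which is why the
  coordinate is symmetric.\<close>

lemma sum_translate:
  fixes g :: "'a::finite_field \<Rightarrow> 'a \<Rightarrow> 'b::comm_monoid_add"
  assumes "(3::'a) = 0" and "d \<noteq> 0"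
  shows "(\<Sum>m\<in>UNIV. g m (m + d)) = (\<Sum>r\<in>UNIV. g (d * (r + 1)) (d * (r - 1)))"
proof -
  have "d * (r + 1) + d = d * (r - 1)" for r
  proof -
    have "d * (r + 1) + d = d * (r - 1) + d * 3" by (simp add: algebra_simps)
    then show ?thesis by (simp add: assms(1))
  qed
  moreover have "(\<Sum>m\<in>UNIV. g m (m + d)) = (\<Sum>r\<in>UNIV. g (d * (r + 1)) (d * (r + 1) + d))"
    by (rule sum.reindex_bij_witness[of _ "\<lambda>r. d * (r + 1)" "\<lambda>m. m / d - 1"]) (use assms(2) in auto)
  ultimately show ?thesis by simp
qed

lemma sum_scale_nonzero:
  fixes g :: "'a::finite_field \<Rightarrow> 'b::comm_monoid_add"
  assumes "d \<noteq> 0"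
  shows "(\<Sum>l\<in>UNIV - {0}. g (l * d)) = (\<Sum>t\<in>UNIV - {0}. g t)"
  by (rule sum.reindex_bij_witness[of _ "\<lambda>t. t / d" "\<lambda>l. l * d"]) (use assms in auto)

lemma measurement_map_energy:
  fixes \<psi>0 :: "'a::finite_field \<Rightarrow> complex"
  assumes "nontrivial_additive_character \<psi>0" and three: "(3::'a) = 0"
  shows "(\<Sum>g\<in>carrier affine_group. (cmod (measurement_map \<psi>0 f A g))\<^sup>2)
    = real CARD('a) * (diagonal_energy f (\<lambda>m. zero_extend A m m)
        + (\<Sum>d\<in>UNIV - {0}. translate_energy f (fiber A d)))"
proof -
  define E where "E l d = (\<Sum>m\<in>UNIV. zero_extend A m (m + d) * (f (l * (m + d)) * cnj (f (l * m))))"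
    for l d
  have "(\<Sum>g\<in>carrier affine_group. (cmod (measurement_map \<psi>0 f A g))\<^sup>2)
      = (\<Sum>l\<in>UNIV - {0}. \<Sum>k\<in>UNIV. (cmod (measurement_map \<psi>0 f A (k, l)))\<^sup>2)"
    unfolding sum.swap[of _ UNIV "UNIV - {0}"]
    by (simp add: affine_group_def sum.cartesian_product)
  also have "\<dots> = (\<Sum>l\<in>UNIV - {0}. sqnorm (dft \<psi>0 (E l)))"
    by (simp add: measurement_map_eq_dft[OF assms(1)] E_def[abs_def])
  also have "\<dots> = real CARD('a) * (\<Sum>l\<in>UNIV - {0}. sqnorm (E l))"
    by (simp only: parseval[OF assms(1)] sum_distrib_left)
  also have "(\<Sum>l\<in>UNIV - {0}. sqnorm (E l)) = (\<Sum>d\<in>UNIV. \<Sum>l\<in>UNIV - {0}. (cmod (E l d))\<^sup>2)"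
    by (rule sum.swap)
  also have "\<dots> = (\<Sum>l\<in>UNIV - {0}. (cmod (E l 0))\<^sup>2)
      + (\<Sum>d\<in>UNIV - {0}. \<Sum>l\<in>UNIV - {0}. (cmod (E l d))\<^sup>2)"
    by (rule sum.remove) auto
  also have "(\<Sum>l\<in>UNIV - {0}. (cmod (E l 0))\<^sup>2) = diagonal_energy f (\<lambda>m. zero_extend A m m)"
    by (simp add: E_def diagonal_energy_def)
  also have "(\<Sum>d\<in>UNIV - {0}. \<Sum>l\<in>UNIV - {0}. (cmod (E l d))\<^sup>2)
      = (\<Sum>d\<in>UNIV - {0}. translate_energy f (fiber A d))"
  proof (rule sum.cong[OF refl])
    fix d :: 'a
    assume "d \<in> UNIV - {0}"
    then have d: "d \<noteq> 0" by simp
    have "E l d = (\<Sum>r\<in>UNIV. fiber A d r * (f (l * d * (r - 1)) * cnj (f (l * d * (r + 1)))))" for l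
      unfolding E_def fiber_def mult.assoc[of l d]
      by (rule sum_translate[OF three d, of "\<lambda>m m'. zero_extend A m m' * (f (l * m') * cnj (f (l * m)))"])
    \<comment> \<open>Both arguments of \<open>f\<close> contain \<open>l * d\<close>, so the
      substitution \<open>t = l * d\<close> removes the dependence on \<open>d\<close>.\<close>
    then show "(\<Sum>l\<in>UNIV - {0}. (cmod (E l d))\<^sup>2) = translate_energy f (fiber A d)"
      by (simp only: translate_energy_def sum_scale_nonzero[OF d,
            of "\<lambda>t. (cmod (\<Sum>r\<in>UNIV. fiber A d r * (f (t * (r - 1)) * cnj (f (t * (r + 1))))))\<^sup>2"])
  qed
  finally show ?thesis .
qed

text \<open>The norm splits along the same differences as the energy, so the two quadratic forms can
  be compared fiber by fiber.\<close>

lemma frobenius_norm_fibers: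
  fixes A :: "'a::finite_field \<Rightarrow> 'a \<Rightarrow> complex"
  assumes "(3::'a) = 0"
  shows "(frobenius_norm_units A)\<^sup>2
    = sqnorm (\<lambda>m. zero_extend A m m) + (\<Sum>d\<in>UNIV - {0}. sqnorm (fiber A d))"
proof -
  have "(frobenius_norm_units A)\<^sup>2 = (\<Sum>p\<in>(UNIV - {0}) \<times> (UNIV - {0}). (case p of (m, m') \<Rightarrow> cmod (A m m'))\<^sup>2)"
    unfolding frobenius_norm_units_def L2_set_def by (intro real_sqrt_pow2 sum_nonneg) simp
  also have "\<dots> = (\<Sum>m\<in>UNIV - {0}. \<Sum>m'\<in>UNIV - {0}. (cmod (A m m'))\<^sup>2)"
    by (simp add: sum.cartesian_product case_prod_unfold)
  also have "\<dots> = (\<Sum>m\<in>UNIV. \<Sum>m'\<in>UNIV. (cmod (zero_extend A m m'))\<^sup>2)"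
    by (intro sum.mono_neutral_cong_left ballI sum.neutral) (auto simp: zero_extend_def)
  also have "\<dots> = (\<Sum>m\<in>UNIV. \<Sum>d\<in>UNIV. (cmod (zero_extend A m (m + d)))\<^sup>2)"
    by (simp only: sum_shift_left_reindex[of "\<lambda>m'. (cmod (zero_extend A _ m'))\<^sup>2"])
  also have "\<dots> = (\<Sum>d\<in>UNIV. \<Sum>m\<in>UNIV. (cmod (zero_extend A m (m + d)))\<^sup>2)"
    by (rule sum.swap)
  also have "\<dots> = (\<Sum>m\<in>UNIV. (cmod (zero_extend A m m))\<^sup>2)
      + (\<Sum>d\<in>UNIV - {0}. \<Sum>m\<in>UNIV. (cmod (zero_extend A m (m + d)))\<^sup>2)"
    using sum.remove[of UNIV 0 "\<lambda>d. \<Sum>m\<in>UNIV. (cmod (zero_extend A m (m + d)))\<^sup>2"] by simp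
  also have "(\<Sum>d\<in>UNIV - {0}. \<Sum>m\<in>UNIV. (cmod (zero_extend A m (m + d)))\<^sup>2)
      = (\<Sum>d\<in>UNIV - {0}. sqnorm (fiber A d))"
    unfolding fiber_def
    by (intro sum.cong refl sum_translate[OF assms, of _ "\<lambda>m m'. (cmod (zero_extend A m m'))\<^sup>2"]) auto
  finally show ?thesis .
qed

text \<open>The missing zero column and zero row become the points \<open>r = 1\<close> and
  \<open>r = - 1\<close>. These are the side conditions on every \<open>C\<close> below.\<close>

lemma fiber_exclusions:
  "fiber A d 1 = 0" "fiber A d (- 1) = 0" "zero_extend A 0 0 = 0"
  by (simp_all add: fiber_def zero_extend_def)

text \<open>Realises an extremal function of the diagonal form by a matrix whose other fibers
  vanish.\<close>

lemma diagonal_matrix: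
  fixes D :: "'a::field \<Rightarrow> complex"
  assumes "D 0 = 0"
  defines "A \<equiv> (\<lambda>m m'. if m = m' then D m else 0)"
  shows "zero_extend A m m = D m" and "d \<noteq> 0 \<Longrightarrow> (3::'a) = 0 \<Longrightarrow> fiber A d r = 0"
proof -
  show "zero_extend A m m = D m"
    by (simp add: zero_extend_def A_def assms(1))
  assume d: "d \<noteq> 0" and three: "(3::'a) = 0"
  have "r + 1 \<noteq> r - 1"
  proof
    assume eq: "r + 1 = r - 1"
    have "(1::'a) = 3 - (r + 1 - (r - 1))" by simp
    also have "\<dots> = 0" unfolding three eq by simp
    finally show False by simp
  qed
  then show "fiber A d r = 0"
    using d by (simp add: fiber_def zero_extend_def A_def)
qed

text \<open>All nonzero differences carry the same form, so one with \<open>d = 1\<close> is enough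
  to realise an extremal \<open>C\<close>. There the row index is \<open>m = r + 1\<close>, hence
  the argument \<open>m - 1\<close>.\<close>

lemma translate_matrix:
  fixes C :: "'a::field \<Rightarrow> complex"
  assumes "C 1 = 0" and "C (- 1) = 0" and three: "(3::'a) = 0"
  defines "A \<equiv> (\<lambda>m m'. if m' = m + 1 then C (m - 1) else 0)"
  shows "zero_extend A m m = 0" and "fiber A 1 r = C r" and "d \<noteq> 1 \<Longrightarrow> fiber A d r = 0"
proof -
  show "zero_extend A m m = 0"
    by (simp add: zero_extend_def A_def)
  have shift: "d * (r - 1) = d * (r + 1) + d" for d
  proof -
    have "d * (r - 1) + d * 3 = d * (r + 1) + d" by (simp add: algebra_simps)
    then show ?thesis by (simp add: three)
  qed
  show "fiber A 1 r = C r"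
    using shift[of 1] assms(1,2)
    by (auto simp: fiber_def zero_extend_def A_def eq_neg_iff_add_eq_0[symmetric])
  show "fiber A d r = 0" if "d \<noteq> 1"
    using that by (simp add: fiber_def zero_extend_def A_def shift)
qed

section \<open>Functions constant on the trace classes\<close>

text \<open>What remains of the trace character is that it is a nontrivial additive character in
  characteristic 3. The order \<open>q\<close> is taken as a real for the later estimates.\<close>

locale ternary_function =
  fixes \<psi> :: "'a::finite_field \<Rightarrow> complex" and a x y q :: real
  assumes three: "(3::'a) = 0" and card: "real CARD('a) = q" and character: "nontrivial_additive_character \<psi>"
begin

definition F :: "'a \<Rightarrow> complex" where
  "F u = of_real a + Complex x y * \<psi> u + cnj (Complex x y) * \<psi> (- u)"

text \<open>The product \<open>F (v - t) * F (v + t)\<close>, as a function of \<open>v\<close>, has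
  constant term \<open>p0\<close> if \<open>\<psi> t = 1\<close> and \<open>p1\<close> otherwise. Up
  to sign, \<open>L1\<close>, \<open>L2\<close> are twice the real and imaginary parts of its
  coefficient at \<open>\<psi> v\<close> in the first case, and \<open>L3\<close>, \<open>L4\<close>
  in the second.\<close>

definition "L1 = 2 * (x\<^sup>2 - y\<^sup>2) + 4 * a * x"
definition "L2 = 4 * y * (x - a)"
definition "L3 = 2 * (x\<^sup>2 - y\<^sup>2) - 2 * a * x"
definition "L4 = 2 * y * (2 * x + a)"
definition "p0 = a\<^sup>2 + 2 * (x\<^sup>2 + y\<^sup>2)"
definition "p1 = a\<^sup>2 - (x\<^sup>2 + y\<^sup>2)"

lemmas psi_add = additive_character_add[OF character]
lemmas psi_zero = additive_character_zero[OF character]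
lemmas psi_uminus = additive_character_uminus[OF character]

section \<open>Cube roots of unity and averages over cosets of the prime field\<close>

lemma q_pos: "q > 0"
  unfolding card[symmetric] by simp

lemma psi_mult_cnj: "\<psi> u * cnj (\<psi> u) = 1"
  using psi_add[of u "- u"] psi_uminus[of u] psi_zero by simp

lemma psi_square: "\<psi> u * \<psi> u = cnj (\<psi> u)"
proof -
  have "\<psi> (u + u) = \<psi> (- u)"
    using three by (intro arg_cong[of _ _ \<psi>]) (simp add: eq_neg_iff_add_eq_0 flip: mult_2 distrib_right)
  then show ?thesis by (simp only: psi_add psi_uminus)
qed

text \<open>The values are cube roots of unity, and the two nontrivial ones have real part -1/2.
  This dichotomy in \<open>t\<close> governs all later formulas.\<close>

lemma psi_cases:
  obtains "\<psi> u = 1" | "\<psi> u \<noteq> 1" "\<psi> u + cnj (\<psi> u) = - 1"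
proof (cases "\<psi> u = 1")
  case False
  have "(\<psi> u - 1) * (\<psi> u + cnj (\<psi> u) + 1) = 0"
    using psi_square[of u] psi_mult_cnj[of u] by (simp add: algebra_simps)
  then show ?thesis
    using that False by (simp add: eq_neg_iff_add_eq_0)
qed

text \<open>In characteristic 3 this is the orthogonal projection onto functions constant on cosets
  of the prime field.\<close>

definition avg :: "('a \<Rightarrow> complex) \<Rightarrow> 'a \<Rightarrow> complex" where
  "avg G r = (G r + G (r + 1) + G (r - 1)) / 3"

text \<open>Shifting by 1 and -1 multiplies the transform by the conjugate of
  \<open>\<psi> t\<close> and by \<open>\<psi> t\<close>. The resulting factor, a third of
  \<open>1 + \<psi> t + cnj (\<psi> t)\<close>, is 1 or 0.\<close>

lemma dft_avg: "dft \<psi> (avg G) t = (if \<psi> t = 1 then dft \<psi> G t else 0)"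
proof -
  have up: "(\<Sum>r\<in>UNIV. G (r + 1) * \<psi> (t * r)) = cnj (\<psi> t) * dft \<psi> G t"
  proof -
    have "(\<Sum>r\<in>UNIV. G (r + 1) * \<psi> (t * r)) = (\<Sum>r\<in>UNIV. G r * \<psi> (t * (r - 1)))"
      using sum_shift_reindex[of "\<lambda>r. G r * \<psi> (t * (r - 1))" 1] by simp
    moreover have "\<psi> (t * (r - 1)) = cnj (\<psi> t) * \<psi> (t * r)" for r
      using psi_add[of "- t" "t * r"] by (simp add: psi_uminus right_diff_distrib)
    ultimately show ?thesis by (simp add: dft_def sum_distrib_left mult_ac)
  qed
  have down: "(\<Sum>r\<in>UNIV. G (r - 1) * \<psi> (t * r)) = \<psi> t * dft \<psi> G t"
  proof -
    have "(\<Sum>r\<in>UNIV. G (r - 1) * \<psi> (t * r)) = (\<Sum>r\<in>UNIV. G r * \<psi> (t * (r + 1)))"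
      using sum_shift_reindex[of "\<lambda>r. G (r - 1) * \<psi> (t * r)" 1] by simp
    moreover have "\<psi> (t * (r + 1)) = \<psi> t * \<psi> (t * r)" for r
      using psi_add[of t "t * r"] by (simp add: distrib_left add.commute)
    ultimately show ?thesis by (simp add: dft_def sum_distrib_left mult_ac)
  qed
  have "3 * dft \<psi> (avg G) t = (\<Sum>r\<in>UNIV. G r * \<psi> (t * r) + G (r + 1) * \<psi> (t * r) + G (r - 1) * \<psi> (t * r))"
    unfolding dft_def sum_distrib_left by (intro sum.cong refl) (simp add: avg_def field_simps)
  also have "\<dots> = (1 + (\<psi> t + cnj (\<psi> t))) * dft \<psi> G t"
    unfolding sum.distrib up down dft_def[of \<psi> G t, symmetric] by (simp add: algebra_simps)
  finally show ?thesis
    by (cases t rule: psi_cases) auto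
qed

lemma sum_avg: "sum (avg G) UNIV = sum G UNIV"
proof -
  have "sum (avg G) UNIV = (sum G UNIV + (\<Sum>r\<in>UNIV. G (r + 1)) + (\<Sum>r\<in>UNIV. G (r - 1))) / 3"
    by (simp add: avg_def[abs_def] sum.distrib sum_divide_distrib[symmetric])
  then show ?thesis
    using sum_shift_reindex[of G 1] sum_shift_reindex[of G "- 1"] by simp
qed

text \<open>The transforms of \<open>avg G\<close> and of \<open>H - avg H\<close> live on
  complementary sets of \<open>t\<close>. Two different functions are allowed because the
  coefficients of the energy depend on whether \<open>\<psi> t = 1\<close>.\<close>

lemma sqnorm_avg_split:
  "sqnorm (avg G) + sqnorm (\<lambda>r. H r - avg H r)
    = (\<Sum>t\<in>UNIV. (cmod (if \<psi> t = 1 then dft \<psi> G t else dft \<psi> H t))\<^sup>2) / q"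
proof -
  have "q * sqnorm (avg G) + q * sqnorm (\<lambda>r. H r - avg H r)
      = sqnorm (dft \<psi> (avg G)) + sqnorm (dft \<psi> (\<lambda>r. H r - avg H r))"
    by (simp only: parseval[OF character] card)
  also have "\<dots> = (\<Sum>t\<in>UNIV. (cmod (if \<psi> t = 1 then dft \<psi> G t else dft \<psi> H t))\<^sup>2)"
    unfolding sum.distrib[symmetric] dft_diff dft_avg by (intro sum.cong refl) simp
  finally show ?thesis
    using q_pos by (simp add: field_simps)
qed

lemma sqnorm_avg: "sqnorm (avg G) + sqnorm (\<lambda>r. G r - avg G r) = sqnorm G"
  unfolding sqnorm_avg_split using q_pos by (simp add: parseval[OF character] card)

section \<open>Products of two values of the function\<close>

lemma cnj_F: "cnj (F u) = F u"
  by (simp add: F_def psi_uminus)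

definition "gam = Complex x y"

lemma F_square:
  "F u * F u = of_real p0 + (2 * of_real a * gam + (cnj gam)\<^sup>2) * \<psi> u + cnj (2 * of_real a * gam + (cnj gam)\<^sup>2) * \<psi> (- u)"
proof -
  have g: "gam * cnj gam = of_real (x\<^sup>2 + y\<^sup>2)"
    by (simp add: gam_def complex_mult_cnj)
  define w where "w = \<psi> u"
  have w: "w * w = cnj w" "w * cnj w = 1" "cnj w * cnj w = w"
    using psi_square[of u] psi_mult_cnj[of u] by (auto simp: w_def) (metis complex_cnj_cnj complex_cnj_mult)
  have "F u * F u = (of_real a + gam * w + cnj gam * cnj w) * (of_real a + gam * w + cnj gam * cnj w)"
    by (simp add: F_def gam_def w_def psi_uminus)
  also have "\<dots> = (of_real a)\<^sup>2 + 2 * (gam * cnj gam) * (w * cnj w) + 2 * of_real a * gam * w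
      + 2 * of_real a * cnj gam * cnj w + gam\<^sup>2 * (w * w) + (cnj gam)\<^sup>2 * (cnj w * cnj w)"
    by (simp add: power2_eq_square algebra_simps)
  also have "\<dots> = of_real p0 + (2 * of_real a * gam + (cnj gam)\<^sup>2) * w + cnj (2 * of_real a * gam + (cnj gam)\<^sup>2) * cnj w"
    unfolding w g by (simp add: p0_def algebra_simps)
  finally show ?thesis by (simp add: w_def psi_uminus)
qed

text \<open>The square of a cube root of unity is its conjugate, so the product stays in the span of
  1, \<psi> and its conjugate. The variable \<open>t\<close> survives only in
  \<open>\<psi> t + cnj (\<psi> t)\<close>, which is 2 or -1.\<close>

lemma F_pair:
  "F (v - t) * F (v + t) =
    (if \<psi> t = 1
     then of_real p0 + (2 * of_real a * gam + (cnj gam)\<^sup>2) * \<psi> v + cnj (2 * of_real a * gam + (cnj gam)\<^sup>2) * \<psi> (- v)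
     else of_real p1 + ((cnj gam)\<^sup>2 - of_real a * gam) * \<psi> v + cnj ((cnj gam)\<^sup>2 - of_real a * gam) * \<psi> (- v))"
proof -
  have g: "gam * cnj gam = of_real (x\<^sup>2 + y\<^sup>2)"
    by (simp add: gam_def complex_mult_cnj)
  define w z where "w = \<psi> v" and "z = \<psi> t"
  have w: "w * w = cnj w" "w * cnj w = 1" "cnj w * cnj w = w"
    using psi_square[of v] psi_mult_cnj[of v] by (auto simp: w_def) (metis complex_cnj_cnj complex_cnj_mult)
  have z: "z * z = cnj z" "z * cnj z = 1" "cnj z * cnj z = z"
    using psi_square[of t] psi_mult_cnj[of t] by (auto simp: z_def) (metis complex_cnj_cnj complex_cnj_mult)
  have minus: "\<psi> (v - t) = w * cnj z" and plus: "\<psi> (v + t) = w * z"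
    using psi_add[of v "- t"] by (simp_all add: w_def z_def psi_uminus psi_add)
  have "F (v - t) * F (v + t)
      = (of_real a + gam * (w * cnj z) + cnj gam * (cnj w * z)) * (of_real a + gam * (w * z) + cnj gam * (cnj w * cnj z))"
    unfolding F_def gam_def[symmetric] psi_uminus minus plus by simp
  also have "\<dots> = (of_real a)\<^sup>2 + (gam * cnj gam) * (w * cnj w) * (cnj z * cnj z + z * z)
      + of_real a * gam * w * (z + cnj z) + of_real a * cnj gam * cnj w * (z + cnj z)
      + gam\<^sup>2 * (w * w) * (z * cnj z) + (cnj gam)\<^sup>2 * (cnj w * cnj w) * (z * cnj z)"
    by (simp add: power2_eq_square algebra_simps)
  also have "\<dots> = (of_real a)\<^sup>2 + of_real (x\<^sup>2 + y\<^sup>2) * (z + cnj z)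
      + of_real a * gam * w * (z + cnj z) + of_real a * cnj gam * cnj w * (z + cnj z)
      + gam\<^sup>2 * cnj w + (cnj gam)\<^sup>2 * w"
    unfolding w z g by simp
  finally have eq: "F (v - t) * F (v + t) = \<dots>" .
  show ?thesis
  proof (cases t rule: psi_cases)
    case 1
    then show ?thesis
      unfolding eq by (simp add: z_def w_def psi_uminus p0_def algebra_simps)
  next
    case 2
    then have "z + cnj z = -1" by (simp add: z_def)
    then show ?thesis
      unfolding eq \<open>z + cnj z = -1\<close> using 2 by (simp add: w_def psi_uminus p1_def algebra_simps)
  qed
qed

section \<open>Even and odd parts\<close>

definition evenp :: "('a \<Rightarrow> complex) \<Rightarrow> 'a \<Rightarrow> complex" where
  "evenp C r = (C r + C (- r)) / 2"

definition oddp :: "('a \<Rightarrow> complex) \<Rightarrow> 'a \<Rightarrow> complex" where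
  "oddp C r = (C r - C (- r)) / 2"

lemma evenp_uminus: "evenp C (- r) = evenp C r" and oddp_uminus: "oddp C (- r) = - oddp C r"
  by (simp_all add: evenp_def oddp_def field_simps)

text \<open>Negation permutes the cosets of the prime field, so averaging respects parity.\<close>

lemma avg_even: "(\<And>r. G (- r) = G r) \<Longrightarrow> avg G (- r) = avg G r"
  unfolding avg_def using minus_add_distrib[of r 1]
  by (metis (no_types, lifting) add.commute add.left_commute diff_minus_eq_add minus_diff_eq uminus_add_conv_diff)

lemma avg_odd:
  assumes "\<And>r. G (- r) = - G r"
  shows "avg G (- r) = - avg G r"
proof -
  have "- r + 1 = - (r - 1)" "- r - 1 = - (r + 1)"
    by simp_all
  then have "G (- r + 1) = - G (r - 1)" "G (- r - 1) = - G (r + 1)"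
    by (simp_all only: assms)
  then show ?thesis by (simp add: avg_def assms[of r] field_simps)
qed

lemma sqnorm_even_odd_split: "sqnorm (evenp C) + sqnorm (oddp C) = sqnorm C"
proof -
  have "C r = evenp C r + oddp C r" for r
    by (simp add: evenp_def oddp_def field_simps)
  then show ?thesis
    using sqnorm_even_plus_odd[of "evenp C" "oddp C"] by (simp add: evenp_uminus oddp_uminus)
qed

lemma sum_evenp: "sum (evenp C) UNIV = sum C UNIV"
  by (simp add: evenp_def[abs_def] sum.distrib sum_uminus_reindex flip: sum_divide_distrib)

text \<open>Reflecting the last summand collects
  \<open>\<delta> * C r + cnj \<delta> * C (- r)\<close>, which weights the even part by twice the
  real part of \<delta> and the odd part by 2i times its imaginary part. The constant term is the
  transform of a point mass at 0.\<close>

lemma sum_symmetrize: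
  "(\<Sum>r\<in>UNIV. C r * (of_real p + \<delta> * \<psi> (t * r) + cnj \<delta> * \<psi> (- (t * r))))
    = dft \<psi> (\<lambda>r. ((if r = 0 then of_real p * sum C UNIV else 0) + of_real (2 * Re \<delta>) * evenp C r)
        + (\<i> * of_real (2 * Im \<delta>)) * oddp C r) t"
proof -
  have sym: "\<delta> * C r + cnj \<delta> * C (- r)
      = of_real (2 * Re \<delta>) * evenp C r + (\<i> * of_real (2 * Im \<delta>)) * oddp C r" for r
  proof -
    have "complex_of_real (2 * Re \<delta>) = \<delta> + cnj \<delta>" "\<i> * complex_of_real (2 * Im \<delta>) = \<delta> - cnj \<delta>"
      by (simp_all add: complex_eq_iff)
    then show ?thesis
      by (simp only: evenp_def oddp_def) (simp add: field_simps)
  qed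
  have "(\<Sum>r\<in>UNIV. C r * (of_real p + \<delta> * \<psi> (t * r) + cnj \<delta> * \<psi> (- (t * r))))
      = of_real p * sum C UNIV + (\<Sum>r\<in>UNIV. \<delta> * C r * \<psi> (t * r))
        + (\<Sum>r\<in>UNIV. cnj \<delta> * C r * \<psi> (- (t * r)))"
    by (simp add: algebra_simps sum.distrib sum_distrib_left)
  also have "(\<Sum>r\<in>UNIV. cnj \<delta> * C r * \<psi> (- (t * r))) = (\<Sum>r\<in>UNIV. cnj \<delta> * C (- r) * \<psi> (t * r))"
    using sum_uminus_reindex[of "\<lambda>r. cnj \<delta> * C (- r) * \<psi> (t * r)"] by simp
  finally have "(\<Sum>r\<in>UNIV. C r * (of_real p + \<delta> * \<psi> (t * r) + cnj \<delta> * \<psi> (- (t * r))))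
      = of_real p * sum C UNIV + (\<Sum>r\<in>UNIV. (\<delta> * C r + cnj \<delta> * C (- r)) * \<psi> (t * r))"
    by (simp only: distrib_right sum.distrib add.assoc)
  also have "of_real p * sum C UNIV = dft \<psi> (\<lambda>r. if r = 0 then of_real p * sum C UNIV else 0) t"
    by (simp add: dft_def if_distrib[of "\<lambda>u. u * _"] psi_zero cong: if_cong)
  also have "(\<Sum>r\<in>UNIV. (\<delta> * C r + cnj \<delta> * C (- r)) * \<psi> (t * r))
      = dft \<psi> (\<lambda>r. of_real (2 * Re \<delta>) * evenp C r + (\<i> * of_real (2 * Im \<delta>)) * oddp C r) t"
    by (simp only: dft_def sym)
  finally show ?thesis
    by (simp only: dft_add add.assoc)
qed

section \<open>The prime field as the exceptional coset\<close>

lemma F_zero: "F 0 = of_real (a + 2 * x)"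
  by (simp add: F_def psi_zero complex_eq_iff)

text \<open>The term at \<open>t = 0\<close>, which Parseval includes and the energies omit; it is
  the source of \<open>Q\<close>.\<close>

lemma cmod_value_zero:
  "(cmod (of_real ((a + 2 * x)\<^sup>2) * z))\<^sup>2 = (a + 2 * x) ^ 4 * (cmod z)\<^sup>2"
  unfolding norm_mult norm_of_real power_mult_distrib power2_abs power_mult[symmetric] by simp

lemma distinct_F3: "(1::'a) \<noteq> - 1" "(- 1::'a) \<noteq> 1"
proof -
  show "(1::'a) \<noteq> - 1"
  proof
    assume *: "(1::'a) = - 1"
    have "(1::'a) = 3 - (1 - - 1)" by simp
    also have "\<dots> = 0" using three * by simp
    finally show False by simp
  qed
  then show "(- 1::'a) \<noteq> 1" by metis
qed

lemma two_eq: "(2::'a) = - 1"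
  using three by (simp add: eq_neg_iff_add_eq_0)

lemma minus_two_eq: "(- 1 - 1 :: 'a) = 1"
  using two_eq by (metis add.inverse_inverse diff_minus_eq_add minus_diff_eq one_add_one uminus_add_conv_diff)

abbreviation "F3 \<equiv> {0, 1, - 1 :: 'a}"

lemma sum_F3: "(\<Sum>r\<in>UNIV. g r) = g 0 + g 1 + g (- 1) + (\<Sum>r\<in>- F3. g r)" for g :: "'a \<Rightarrow> real"
proof -
  have "(\<Sum>r\<in>UNIV. g r) = (\<Sum>r\<in>F3. g r) + (\<Sum>r\<in>- F3. g r)"
    by (subst sum.union_disjoint[symmetric]) auto
  then show ?thesis by (simp add: distinct_F3)
qed

lemma avg_F3:
  assumes "G 1 = 0" "G (- 1) = 0"
  shows "avg G 0 = G 0 / 3" "avg G 1 = G 0 / 3" "avg G (- 1) = G 0 / 3"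
proof -
  show "avg G 0 = G 0 / 3" "avg G 1 = G 0 / 3" "avg G (- 1) = G 0 / 3"
    by (simp_all add: avg_def assms two_eq minus_two_eq)
qed

text \<open>On the prime field only the value at 0 is free. A third of its squared norm belongs to
  the coset average and two thirds to the remainder, hence these weights in the energy.\<close>

lemma sqnorm_avg_F3:
  assumes "G 1 = 0" "G (- 1) = 0"
  shows "sqnorm (avg G) = (cmod (G 0))\<^sup>2 / 3 + (\<Sum>r\<in>- F3. (cmod (avg G r))\<^sup>2)"
    and "sqnorm (\<lambda>r. G r - avg G r) = 2 / 3 * (cmod (G 0))\<^sup>2 + (\<Sum>r\<in>- F3. (cmod (G r - avg G r))\<^sup>2)"
proof -
  show "sqnorm (avg G) = (cmod (G 0))\<^sup>2 / 3 + (\<Sum>r\<in>- F3. (cmod (avg G r))\<^sup>2)"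
    unfolding sum_F3 avg_F3[OF assms] by (simp add: norm_divide power_divide)
  have "G 0 - G 0 / 3 = 2 / 3 * G 0" by simp
  then show "sqnorm (\<lambda>r. G r - avg G r) = 2 / 3 * (cmod (G 0))\<^sup>2 + (\<Sum>r\<in>- F3. (cmod (G r - avg G r))\<^sup>2)"
    unfolding sum_F3 avg_F3[OF assms] assms by (simp add: norm_mult norm_divide power_divide power_mult_distrib)
qed

text \<open>The point mass at 0 is invisible on every other coset.\<close>

lemma avg_off_F3:
  assumes "r \<in> - F3"
  shows "avg (\<lambda>r. (if r = 0 then s else 0) + z * G r) r = z * avg G r"
proof -
  have "r \<noteq> 0" "r + 1 \<noteq> 0" "r - 1 \<noteq> 0"
    using assms by (auto simp: eq_neg_iff_add_eq_0)
  then show ?thesis by (simp add: avg_def field_simps)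
qed

lemma avg_add_cmult: "avg (\<lambda>r. G r + z * H r) r = avg G r + z * avg H r"
  by (simp add: avg_def field_simps)

lemma sqnorm_cmult: "sqnorm (\<lambda>r. z * G r) = (cmod z)\<^sup>2 * sqnorm G"
  by (simp add: norm_mult power_mult_distrib sum_distrib_left)

lemma sum_nonzero: "(\<Sum>t\<in>UNIV - {0}. g t) = (\<Sum>t\<in>UNIV. g t) - g 0" for g :: "'a \<Rightarrow> real"
  by (simp add: sum_diff1)

text \<open>Parity and averaging commute, so the energy splits into four orthogonal pieces weighted
  by \<open>L1\<close> to \<open>L4\<close>. The point masses disturb only the even pieces on the
  prime field, where they couple \<open>C 0\<close> with the total sum.\<close>

lemma translate_energy_eq:
  assumes "C 1 = 0" "C (- 1) = 0"
  shows "translate_energy F C =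
    q * ((cmod (of_real p0 * sum C UNIV + of_real L1 * C 0))\<^sup>2 / 3
       + 2 / 3 * (cmod (of_real p1 * sum C UNIV + of_real L3 * C 0))\<^sup>2
       + L1\<^sup>2 * (\<Sum>r\<in>- F3. (cmod (avg (evenp C) r))\<^sup>2)
       + L3\<^sup>2 * (\<Sum>r\<in>- F3. (cmod (evenp C r - avg (evenp C) r))\<^sup>2)
       + L2\<^sup>2 * sqnorm (avg (oddp C)) + L4\<^sup>2 * sqnorm (\<lambda>r. oddp C r - avg (oddp C) r))
    - (a + 2 * x) ^ 4 * (cmod (sum C UNIV))\<^sup>2"
proof -
  define \<delta>0 \<delta>1 where "\<delta>0 = 2 * of_real a * gam + (cnj gam)\<^sup>2" and "\<delta>1 = (cnj gam)\<^sup>2 - of_real a * gam"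
  have \<delta>: "2 * Re \<delta>0 = L1" "2 * Im \<delta>0 = - L2" "2 * Re \<delta>1 = L3" "2 * Im \<delta>1 = - L4"
    by (simp_all add: \<delta>0_def \<delta>1_def gam_def L1_def L2_def L3_def L4_def power2_eq_square algebra_simps)
  define E O' where "E = evenp C" and "O' = oddp C"
  \<comment> \<open>The even parts of the functions whose transforms give \<open>h t\<close>:
    \<open>G\<close> for \<open>\<psi> t = 1\<close> and \<open>H\<close> otherwise.\<close>
  define G H where "G = (\<lambda>r. (if r = 0 then of_real p0 * sum C UNIV else 0) + of_real L1 * E r)"
    and "H = (\<lambda>r. (if r = 0 then of_real p1 * sum C UNIV else 0) + of_real L3 * E r)"
  define h where "h t = (\<Sum>r\<in>UNIV. C r * (F (t * (r - 1)) * cnj (F (t * (r + 1)))))" for t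
  have h: "h t = (if \<psi> t = 1 then dft \<psi> (\<lambda>r. G r + (- \<i> * of_real L2) * O' r) t
      else dft \<psi> (\<lambda>r. H r + (- \<i> * of_real L4) * O' r) t)" for t
  proof -
    have "h t = (\<Sum>r\<in>UNIV. C r * (F (t * r - t) * F (t * r + t)))"
      by (simp add: h_def cnj_F algebra_simps)
    then show ?thesis
      unfolding F_pair \<delta>0_def[symmetric] \<delta>1_def[symmetric]
      using sum_symmetrize[of C p0 \<delta>0 t] sum_symmetrize[of C p1 \<delta>1 t]
      by (simp add: \<delta> G_def H_def E_def O'_def)
  qed
  have E_F3: "E 1 = 0" "E (- 1) = 0" "E 0 = C 0"
    using assms by (simp_all add: E_def evenp_def)
  have GH_F3: "G 1 = 0" "G (- 1) = 0" "H 1 = 0" "H (- 1) = 0"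
    by (simp_all add: G_def H_def E_F3)
  have even: "G (- r) = G r" "H (- r) = H r" for r
    by (simp_all add: G_def H_def E_def evenp_uminus)
  have odd: "O' (- r) = - O' r" for r
    by (simp add: O'_def oddp_uminus)
  have "translate_energy F C = (\<Sum>t\<in>UNIV. (cmod (h t))\<^sup>2) - (cmod (h 0))\<^sup>2"
    unfolding translate_energy_def h_def[symmetric] by (rule sum_nonzero)
  also have "h 0 = of_real ((a + 2 * x)\<^sup>2) * sum C UNIV"
    by (simp add: h_def F_zero power2_eq_square mult.commute flip: sum_distrib_right)
  also have "(\<Sum>t\<in>UNIV. (cmod (h t))\<^sup>2)
      = q * (sqnorm (avg (\<lambda>r. G r + (- \<i> * of_real L2) * O' r))
          + sqnorm (\<lambda>r. (H r + (- \<i> * of_real L4) * O' r) - avg (\<lambda>r. H r + (- \<i> * of_real L4) * O' r) r))"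
    unfolding sqnorm_avg_split h using q_pos by simp
  also have "sqnorm (avg (\<lambda>r. G r + (- \<i> * of_real L2) * O' r))
      = sqnorm (\<lambda>r. avg G r + (- \<i> * of_real L2) * avg O' r)"
    by (simp only: avg_add_cmult)
  also have "\<dots> = sqnorm (avg G) + sqnorm (\<lambda>r. (- \<i> * of_real L2) * avg O' r)"
    by (rule sqnorm_even_plus_odd) (simp_all add: avg_even avg_odd even odd)
  also have "sqnorm (\<lambda>r. (H r + (- \<i> * of_real L4) * O' r) - avg (\<lambda>r. H r + (- \<i> * of_real L4) * O' r) r)
      = sqnorm (\<lambda>r. (H r - avg H r) + (- \<i> * of_real L4) * (O' r - avg O' r))"
    \<comment> \<open>Regrouping into an even and an odd summand, so that their cross terms
      vanish.\<close>
    unfolding avg_add_cmult by (intro sum.cong refl arg_cong[of _ _ "\<lambda>z. (cmod z)\<^sup>2"]) (simp add: algebra_simps)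
  also have "\<dots> = sqnorm (\<lambda>r. H r - avg H r) + sqnorm (\<lambda>r. (- \<i> * of_real L4) * (O' r - avg O' r))"
    by (rule sqnorm_even_plus_odd) (simp_all add: avg_even avg_odd even odd algebra_simps)
  also have "sqnorm (avg G) = (cmod (of_real p0 * sum C UNIV + of_real L1 * C 0))\<^sup>2 / 3
      + L1\<^sup>2 * (\<Sum>r\<in>- F3. (cmod (avg E r))\<^sup>2)"
  proof -
    have "avg G r = of_real L1 * avg E r" if "r \<in> - F3" for r
      unfolding G_def by (rule avg_off_F3[OF that])
    then have "(\<Sum>r\<in>- F3. (cmod (avg G r))\<^sup>2) = L1\<^sup>2 * (\<Sum>r\<in>- F3. (cmod (avg E r))\<^sup>2)"
      unfolding sum_distrib_left by (intro sum.cong refl) (simp add: norm_mult power_mult_distrib)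
    then show ?thesis
      unfolding sqnorm_avg_F3(1)[OF GH_F3(1,2)] by (simp add: G_def E_F3)
  qed
  also have "sqnorm (\<lambda>r. H r - avg H r) = 2 / 3 * (cmod (of_real p1 * sum C UNIV + of_real L3 * C 0))\<^sup>2
      + L3\<^sup>2 * (\<Sum>r\<in>- F3. (cmod (E r - avg E r))\<^sup>2)"
  proof -
    have "H r - avg H r = of_real L3 * (E r - avg E r)" if "r \<in> - F3" for r
      unfolding H_def avg_off_F3[OF that] using that by (simp add: algebra_simps)
    then have "(\<Sum>r\<in>- F3. (cmod (H r - avg H r))\<^sup>2) = L3\<^sup>2 * (\<Sum>r\<in>- F3. (cmod (E r - avg E r))\<^sup>2)"
      unfolding sum_distrib_left by (intro sum.cong refl) (simp add: norm_mult power_mult_distrib)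
    then show ?thesis
      unfolding sqnorm_avg_F3(2)[OF GH_F3(3,4)] by (simp add: H_def E_F3)
  qed
  finally show ?thesis
    unfolding E_def O'_def sqnorm_cmult cmod_value_zero
    by (simp add: norm_mult power_mult_distrib algebra_simps)
qed

text \<open>Here the two arguments of \<open>F\<close> coincide, so only the coefficients of
  \<open>F_square\<close> occur and no coset average enters.\<close>

lemma diagonal_energy_eq:
  assumes "D 0 = 0"
  shows "diagonal_energy F D = q * (p0\<^sup>2 * (cmod (sum D UNIV))\<^sup>2 + L1\<^sup>2 * sqnorm (evenp D) + L2\<^sup>2 * sqnorm (oddp D))
    - (a + 2 * x) ^ 4 * (cmod (sum D UNIV))\<^sup>2"
proof -
  define \<delta>0 where "\<delta>0 = 2 * of_real a * gam + (cnj gam)\<^sup>2"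
  have \<delta>: "2 * Re \<delta>0 = L1" "2 * Im \<delta>0 = - L2"
    by (simp_all add: \<delta>0_def gam_def L1_def L2_def power2_eq_square algebra_simps)
  define G where "G = (\<lambda>r. (if r = 0 then of_real p0 * sum D UNIV else 0) + of_real L1 * evenp D r)"
  define h where "h t = (\<Sum>m\<in>UNIV. D m * (F (t * m) * cnj (F (t * m))))" for t
  have h: "h t = dft \<psi> (\<lambda>r. G r + (- \<i> * of_real L2) * oddp D r) t" for t
    unfolding h_def cnj_F F_square \<delta>0_def[symmetric] using sum_symmetrize[of D p0 \<delta>0 t]
    by (simp add: \<delta> G_def)
  have "diagonal_energy F D = sqnorm h - (cmod (h 0))\<^sup>2"
    unfolding diagonal_energy_def h_def[symmetric] by (rule sum_nonzero)
  also have "h 0 = of_real ((a + 2 * x)\<^sup>2) * sum D UNIV"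
    by (simp add: h_def F_zero power2_eq_square mult.commute flip: sum_distrib_right)
  also have "sqnorm h = q * sqnorm (\<lambda>r. G r + (- \<i> * of_real L2) * oddp D r)"
    unfolding h using parseval[OF character] card by simp
  also have "sqnorm (\<lambda>r. G r + (- \<i> * of_real L2) * oddp D r)
      = sqnorm G + sqnorm (\<lambda>r. (- \<i> * of_real L2) * oddp D r)"
    by (rule sqnorm_even_plus_odd) (simp_all add: G_def evenp_uminus oddp_uminus)
  \<comment> \<open>The point mass sits at 0, where \<open>D\<close> vanishes, so there is no cross
    term.\<close>
  also have "sqnorm G = p0\<^sup>2 * (cmod (sum D UNIV))\<^sup>2 + L1\<^sup>2 * sqnorm (evenp D)"
  proof -
    have "(cmod (G r))\<^sup>2 = (if r = 0 then p0\<^sup>2 * (cmod (sum D UNIV))\<^sup>2 else 0) + L1\<^sup>2 * (cmod (evenp D r))\<^sup>2" for r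
      using assms by (auto simp: G_def evenp_def norm_mult norm_divide power_mult_distrib power_divide)
    then show ?thesis
      by (simp add: sum.distrib sum_distrib_left)
  qed
  finally show ?thesis
    unfolding sqnorm_cmult cmod_value_zero
    by (simp add: norm_mult power_mult_distrib algebra_simps)
qed

end

section \<open>Lower bounds for the energies\<close>

lemma cmod_sum_squared_le:
  "(cmod (sum G A))\<^sup>2 \<le> real (card A) * (\<Sum>r\<in>A. (cmod (G r))\<^sup>2)"
proof -
  have "(cmod (sum G A))\<^sup>2 \<le> (\<Sum>r\<in>A. cmod (G r))\<^sup>2"
    by (intro power_mono norm_sum) simp
  also have "\<dots> \<le> (L2_set (\<lambda>r. cmod (G r)) A * L2_set (\<lambda>r. 1) A)\<^sup>2"
    using L2_set_mult_ineq[of "\<lambda>r. cmod (G r)" "\<lambda>r. 1" A] by (intro power_mono) (auto intro: sum_nonneg)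
  also have "\<dots> = real (card A) * (\<Sum>r\<in>A. (cmod (G r))\<^sup>2)"
    by (simp add: L2_set_def power_mult_distrib sum_nonneg)
  finally show ?thesis .
qed

locale large_ternary_function = ternary_function +
  assumes q_ge: "q \<ge> 9"
begin

definition "N = q * p0 - (a + 2 * x)\<^sup>2"
definition "n = q - 3"

text \<open>The form with matrix \<open>N\<^sup>2\<close> times \<open>K\<close>. Here \<alpha> is
  the value at 0, \<beta> the coordinate along the unit constant vector off the prime field (which
  has n points), and \<open>s\<close> the total sum.\<close>

definition kform :: "real \<Rightarrow> real \<Rightarrow> real" where
  "kform \<alpha> \<beta> = (let s = \<alpha> + sqrt n * \<beta> in
     q * ((p0 * s + L1 * \<alpha>)\<^sup>2 / 3 + 2 / 3 * (p1 * s + L3 * \<alpha>)\<^sup>2 + L1\<^sup>2 * \<beta>\<^sup>2) - (a + 2 * x) ^ 4 * s\<^sup>2)"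

lemma n_pos: "n > 0"
  using q_ge by (simp add: n_def)

lemma card_off_F3: "real (card (- F3)) = n"
proof -
  have "card (- F3) = CARD('a) - 3"
    by (simp add: Compl_eq_Diff_UNIV card_Diff_subset distinct_F3)
  moreover have "CARD('a) \<ge> 3"
    using card q_ge by linarith
  ultimately show ?thesis
    using card by (simp add: n_def of_nat_diff)
qed

lemma sum_F3_complex: "(\<Sum>r\<in>UNIV. g r) = g 0 + g 1 + g (- 1) + (\<Sum>r\<in>- F3. g r)" for g :: "'a \<Rightarrow> complex"
proof -
  have "(\<Sum>r\<in>UNIV. g r) = (\<Sum>r\<in>F3. g r) + (\<Sum>r\<in>- F3. g r)"
    by (subst sum.union_disjoint[symmetric]) auto
  then show ?thesis by (simp add: distinct_F3)
qed

text \<open>\<open>F\<close> takes the value a + 2x where \<psi> is 1, and a - x plus or minus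
  sqrt(3) y on the other two classes. Each class has q/3 elements, and 0 is removed from the
  first.\<close>

lemma N_ge: "q / 3 * (2 * (a - x)\<^sup>2 + 6 * y\<^sup>2) \<le> N"
  and N_eq: "N = (q / 3 - 1) * (a + 2 * x)\<^sup>2 + q / 3 * (2 * (a - x)\<^sup>2 + 6 * y\<^sup>2)"
proof -
  show eq: "N = (q / 3 - 1) * (a + 2 * x)\<^sup>2 + q / 3 * (2 * (a - x)\<^sup>2 + 6 * y\<^sup>2)"
    by (simp add: N_def p0_def power2_eq_square field_simps)
  show "q / 3 * (2 * (a - x)\<^sup>2 + 6 * y\<^sup>2) \<le> N"
    unfolding eq using q_ge by simp
qed

text \<open>Ensures that the eigenvalue on constants in the diagonal form never lowers the
  minimum.\<close>

lemma L2_le_N: "q * L2\<^sup>2 \<le> N\<^sup>2"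
proof -
  define X where "X = 2 * (a - x)\<^sup>2 + 6 * y\<^sup>2"
  \<comment> \<open>The identity 4AB + (A - B)^2 = (A + B)^2 with A = 2(a - x)^2 and B =
    6y^2.\<close>
  have "3 * L2\<^sup>2 + (2 * (a - x)\<^sup>2 - 6 * y\<^sup>2)\<^sup>2 = X\<^sup>2"
    by (simp add: X_def L2_def power2_eq_square algebra_simps)
  then have X: "3 * L2\<^sup>2 \<le> X\<^sup>2"
    using zero_le_power2[of "2 * (a - x)\<^sup>2 - 6 * y\<^sup>2"] by linarith
  have "q * L2\<^sup>2 \<le> q * (q / 3 * L2\<^sup>2)"
    using q_ge by (intro mult_left_mono) (simp_all add: mult_right_mono[of 1 "q / 3" "L2\<^sup>2", simplified])
  also have "\<dots> = (q / 3)\<^sup>2 * (3 * L2\<^sup>2)"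
    by (simp add: power2_eq_square)
  also have "\<dots> \<le> (q / 3)\<^sup>2 * X\<^sup>2"
    using X by (intro mult_left_mono) auto
  also have "\<dots> = (q / 3 * X)\<^sup>2"
    by (rule power_mult_distrib[symmetric])
  also have "\<dots> \<le> N\<^sup>2"
    using N_ge q_ge unfolding X_def by (intro power_mono) auto
  finally show ?thesis .
qed

lemma N_pos:
  assumes "F u \<noteq> 0"
  shows "N > 0"
proof (rule ccontr)
  assume "\<not> N > 0"
  moreover have "(q / 3 - 1) * (a + 2 * x)\<^sup>2 \<ge> 0" "q / 3 * (2 * (a - x)\<^sup>2 + 6 * y\<^sup>2) \<ge> 0"
    using q_ge by auto
  ultimately have "(q / 3 - 1) * (a + 2 * x)\<^sup>2 = 0" "q / 3 * (2 * (a - x)\<^sup>2 + 6 * y\<^sup>2) = 0"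
    unfolding N_eq by linarith+
  then have "a + 2 * x = 0" "2 * (a - x)\<^sup>2 + 6 * y\<^sup>2 = 0"
    using q_ge by auto
  then have "a + 2 * x = 0" "a - x = 0" "y = 0"
    by (simp_all add: add_nonneg_eq_0_iff)
  then have "a = 0" "x = 0" "y = 0" by auto
  then have "F u = 0"
    unfolding F_def by (simp add: complex_eq_iff)
  with assms show False ..
qed

lemma sum_F_square: "(\<Sum>u\<in>UNIV - {0}. (cmod (F u))\<^sup>2) = N"
proof -
  define \<delta>0 where "\<delta>0 = 2 * of_real a * gam + (cnj gam)\<^sup>2"
  have "(\<Sum>u\<in>UNIV. \<psi> u) = 0" "(\<Sum>u\<in>UNIV. \<psi> (- u)) = 0"
    using sum_additive_character[OF character, of 1] sum_additive_character[OF character, of "- 1"] by simp_all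
  moreover have "complex_of_nat CARD('a) = of_real q"
    unfolding card[symmetric] by simp
  ultimately have "(\<Sum>u\<in>UNIV. F u * F u) = of_real (q * p0)"
    unfolding F_square \<delta>0_def[symmetric]
    by (simp add: sum.distrib flip: sum_distrib_left)
  moreover have "complex_of_real (\<Sum>u\<in>UNIV. (cmod (F u))\<^sup>2) = (\<Sum>u\<in>UNIV. F u * F u)"
    by (simp only: of_real_sum complex_norm_square cnj_F)
  ultimately have "(\<Sum>u\<in>UNIV. (cmod (F u))\<^sup>2) = q * p0"
    by (simp only: of_real_eq_iff)
  then show ?thesis
    by (simp add: sum_nonzero F_zero N_def flip: of_real_add of_real_mult)
qed

lemma diagonal_energy_ge:
  assumes "D 0 = 0" and "\<theta> \<le> q * L1\<^sup>2" "\<theta> \<le> q * L2\<^sup>2"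
  shows "diagonal_energy F D \<ge> \<theta> * sqnorm D"
proof -
  define s where "s = (cmod (sum D UNIV))\<^sup>2"
  \<comment> \<open>The squared norm of the projection of \<open>D\<close> onto the constants on the
    q - 1 units.\<close>
  define w where "w = s / (q - 1)"
  have s: "s = (q - 1) * w"
    using q_ge by (simp add: w_def)
  have "evenp D 0 = 0"
    using assms(1) by (simp add: evenp_def)
  then have "(cmod (sum (evenp D) (UNIV - {0})))\<^sup>2 = s" "(\<Sum>r\<in>UNIV - {0}. (cmod (evenp D r))\<^sup>2) = sqnorm (evenp D)"
    by (simp_all add: sum_diff1 sum_evenp s_def)
  moreover have "real (card (UNIV - {0 :: 'a})) = q - 1"
    using card q_ge by (simp add: card_Diff_singleton of_nat_diff)
  ultimately have "s \<le> (q - 1) * sqnorm (evenp D)"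
    using cmod_sum_squared_le[of "evenp D" "UNIV - {0}"] by simp
  then have w: "w \<le> sqnorm (evenp D)"
    unfolding s using q_ge by simp
  have "w \<ge> 0"
    using q_ge by (simp add: w_def s_def)
  \<comment> \<open>The relation p0 + L1 = (a + 2x)^2 is what turns the coefficient on constants
    into \<open>N\<^sup>2\<close>.\<close>
  have N: "N = q * p0 - (p0 + L1)" and Q: "(a + 2 * x) ^ 4 = (p0 + L1)\<^sup>2"
    by (simp_all add: N_def p0_def L1_def power2_eq_square power4_eq_xxxx algebra_simps)
  have "diagonal_energy F D = N\<^sup>2 * w + q * L1\<^sup>2 * (sqnorm (evenp D) - w) + q * L2\<^sup>2 * sqnorm (oddp D)"
    unfolding diagonal_energy_eq[of D, OF assms(1)] s_def[symmetric] s N Q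
    by (simp add: power2_eq_square algebra_simps)
  also have "\<dots> \<ge> \<theta> * w + \<theta> * (sqnorm (evenp D) - w) + \<theta> * sqnorm (oddp D)"
    using assms(2,3) L2_le_N w \<open>w \<ge> 0\<close> by (intro add_mono mult_right_mono) (auto intro: sum_nonneg)
  finally show ?thesis
    unfolding sqnorm_even_odd_split[of D, symmetric] by (simp add: algebra_simps)
qed

text \<open>The coefficients are real, so real and imaginary parts separate.\<close>

lemma kform_complex:
  assumes "s = \<alpha> + of_real (sqrt n) * \<beta>"
  shows "q * ((cmod (of_real p0 * s + of_real L1 * \<alpha>))\<^sup>2 / 3
       + 2 / 3 * (cmod (of_real p1 * s + of_real L3 * \<alpha>))\<^sup>2 + L1\<^sup>2 * (cmod \<beta>)\<^sup>2)
      - (a + 2 * x) ^ 4 * (cmod s)\<^sup>2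
    = kform (Re \<alpha>) (Re \<beta>) + kform (Im \<alpha>) (Im \<beta>)"
  unfolding cmod_power2 kform_def Let_def assms by (simp add: algebra_simps)

text \<open>Off the prime field the even coset averages consist of the constant component, which
  couples to \<alpha> in \<open>kform\<close>, and its orthogonal complement, on which the form is
  \<open>q * L1\<^sup>2\<close>. All other pieces are already diagonal.\<close>

lemma translate_energy_ge:
  assumes C: "C 1 = 0" "C (- 1) = 0"
    and \<theta>: "\<theta> \<le> q * L1\<^sup>2" "\<theta> \<le> q * L2\<^sup>2" "\<theta> \<le> q * L3\<^sup>2" "\<theta> \<le> q * L4\<^sup>2"
    and form: "\<And>\<alpha> \<beta>. \<theta> * (\<alpha>\<^sup>2 + \<beta>\<^sup>2) \<le> kform \<alpha> \<beta>"
  shows "translate_energy F C \<ge> \<theta> * sqnorm C"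
proof -
  define E where "E = evenp C"
  define \<alpha> s \<beta> where "\<alpha> = C 0" and "s = sum C UNIV" and "\<beta> = (s - \<alpha>) / of_real (sqrt n)"
  define \<tau> \<rho> where "\<tau> = (\<Sum>r\<in>- F3. (cmod (avg E r))\<^sup>2)" and "\<rho> = (\<Sum>r\<in>- F3. (cmod (E r - avg E r))\<^sup>2)"
  have s: "s = \<alpha> + of_real (sqrt n) * \<beta>"
    using n_pos by (simp add: \<beta>_def)
  have E: "E 1 = 0" "E (- 1) = 0" "E 0 = \<alpha>"
    using C by (simp_all add: E_def evenp_def \<alpha>_def)
  have "sum (avg E) UNIV = s"
    by (simp add: sum_avg E_def sum_evenp s_def)
  \<comment> \<open>Averaging spreads \<alpha> in thirds over the prime field but keeps its sum
    there, so the rest of \<open>s\<close> comes from outside. Cauchy-Schwarz over n points then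
    bounds \<beta>.\<close>
  then have "s - \<alpha> = sum (avg E) (- F3)"
    unfolding sum_F3_complex avg_F3[OF E(1,2)] E(3) by (simp add: field_simps)
  then have "(cmod (s - \<alpha>))\<^sup>2 \<le> n * \<tau>"
    using cmod_sum_squared_le[of "avg E" "- F3"] by (simp only: card_off_F3 \<tau>_def)
  then have \<tau>: "(cmod \<beta>)\<^sup>2 \<le> \<tau>"
    using n_pos by (simp add: \<beta>_def norm_divide power_divide field_simps)
  have "\<rho> \<ge> 0" by (auto simp: \<rho>_def intro: sum_nonneg)
  have "sqnorm E = (cmod \<alpha>)\<^sup>2 + \<tau> + \<rho>"
    unfolding sqnorm_avg[of E, symmetric] sqnorm_avg_F3[OF E(1,2)] E(3) \<tau>_def \<rho>_def by simp
  then have norm: "sqnorm C = (cmod \<alpha>)\<^sup>2 + \<tau> + \<rho> + sqnorm (avg (oddp C)) + sqnorm (\<lambda>r. oddp C r - avg (oddp C) r)"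
    using sqnorm_even_odd_split[of C] sqnorm_avg[of "oddp C"] by (simp add: E_def)
  have "translate_energy F C = (kform (Re \<alpha>) (Re \<beta>) + kform (Im \<alpha>) (Im \<beta>)) + q * L1\<^sup>2 * (\<tau> - (cmod \<beta>)\<^sup>2)
      + q * L3\<^sup>2 * \<rho> + q * L2\<^sup>2 * sqnorm (avg (oddp C)) + q * L4\<^sup>2 * sqnorm (\<lambda>r. oddp C r - avg (oddp C) r)"
    unfolding translate_energy_eq[OF C] kform_complex[OF s, symmetric]
      s_def[symmetric] \<alpha>_def[symmetric] E_def[symmetric] \<tau>_def[symmetric] \<rho>_def[symmetric]
    by (simp add: algebra_simps)
  also have "\<dots> \<ge> (\<theta> * ((Re \<alpha>)\<^sup>2 + (Re \<beta>)\<^sup>2) + \<theta> * ((Im \<alpha>)\<^sup>2 + (Im \<beta>)\<^sup>2)) + \<theta> * (\<tau> - (cmod \<beta>)\<^sup>2)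
      + \<theta> * \<rho> + \<theta> * sqnorm (avg (oddp C)) + \<theta> * sqnorm (\<lambda>r. oddp C r - avg (oddp C) r)"
    using \<tau> \<open>\<rho> \<ge> 0\<close> by (intro add_mono mult_right_mono form \<theta>) (auto intro: sum_nonneg)
  finally show ?thesis
    unfolding norm cmod_power2[of \<alpha>] cmod_power2[of \<beta>] by (simp add: algebra_simps)
qed

text \<open>The identity (u + 2v)^2/3 + 2(u - v)^2/3 = u^2 + 2v^2 produces \<open>V\<close> for u =
  a^2 + b, v = e + c and \<open>W\<close> for u = a^2, v = e; its polarisation produces
  \<open>Z\<close>.\<close>

lemma kform_eq:
  assumes "e = x\<^sup>2 + y\<^sup>2" "b = 2 * (x\<^sup>2 - y\<^sup>2)" "c = 2 * a * x"
  shows "kform \<alpha> \<beta> =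
    (q * ((a\<^sup>2 + b)\<^sup>2 + 2 * (e + c)\<^sup>2) - (a + 2 * x) ^ 4) * \<alpha>\<^sup>2
    + 2 * (sqrt n * (q * (a\<^sup>2 * (a\<^sup>2 + b) + 2 * e * (e + c)) - (a + 2 * x) ^ 4)) * (\<alpha> * \<beta>)
    + (q * ((b + 2 * c)\<^sup>2 + n * (a ^ 4 + 2 * e\<^sup>2)) - n * (a + 2 * x) ^ 4) * \<beta>\<^sup>2"
proof -
  have L: "p0 = a\<^sup>2 + 2 * e" "p1 = a\<^sup>2 - e" "L1 = b + 2 * c" "L3 = b - c"
    by (simp_all add: p0_def p1_def L1_def L3_def assms)
  define t where "t = sqrt n"
  have n: "n = t\<^sup>2" using n_pos by (simp add: t_def)
  show ?thesis
    unfolding kform_def Let_def L t_def[symmetric] n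
    by (simp add: power2_eq_square power4_eq_xxxx field_simps)
qed

end

section \<open>Symmetric real matrices of size two\<close>

lemma eigenvalue_symmetric_2x2:
  fixes P R s k :: "'b::field"
  shows "eigenvalue (mat_of_rows_list 2 [[P, s], [s, R]]) k \<longleftrightarrow> (P - k) * (R - k) = s * s"
proof -
  let ?K = "mat_of_rows_list 2 [[P, s], [s, R]]"
  have K: "dim_row ?K = 2"
    by (simp add: mat_of_rows_list_def)
  have mult: "?K *\<^sub>v v = k \<cdot>\<^sub>v v \<longleftrightarrow> P * v $ 0 + s * v $ 1 = k * v $ 0 \<and> s * v $ 0 + R * v $ 1 = k * v $ 1"
    if "v \<in> carrier_vec 2" for v
    using that
    by (auto simp: vec_eq_iff mat_of_rows_list_def scalar_prod_def numeral_2_eq_2 less_Suc_eq all_conj_distrib)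
  have zero: "v = 0\<^sub>v 2 \<longleftrightarrow> v $ 0 = 0 \<and> v $ 1 = 0" if "v \<in> carrier_vec 2" for v :: "'b vec"
    using that by (auto simp: vec_eq_iff numeral_2_eq_2 less_Suc_eq)
  show ?thesis
  proof
    assume "eigenvalue ?K k"
    then obtain v where "v \<in> carrier_vec 2" "v \<noteq> 0\<^sub>v 2" "?K *\<^sub>v v = k \<cdot>\<^sub>v v"
      unfolding eigenvalue_def eigenvector_def K by blast
    then have v: "v $ 0 \<noteq> 0 \<or> v $ 1 \<noteq> 0" "(P - k) * v $ 0 = - (s * v $ 1)" "(R - k) * v $ 1 = - (s * v $ 0)"
      using mult zero by (auto simp: algebra_simps eq_neg_iff_add_eq_0)
    \<comment> \<open>Multiplication by the adjugate: the determinant annihilates both coordinates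
      of an eigenvector.\<close>
    have "((P - k) * (R - k) - s * s) * v $ 0 = (R - k) * ((P - k) * v $ 0) - s * (s * v $ 0)"
      "((P - k) * (R - k) - s * s) * v $ 1 = (P - k) * ((R - k) * v $ 1) - s * (s * v $ 1)"
      by (simp_all add: algebra_simps)
    moreover have "(R - k) * (s * v $ 1) = s * ((R - k) * v $ 1)" "(P - k) * (s * v $ 0) = s * ((P - k) * v $ 0)"
      by simp_all
    ultimately have "((P - k) * (R - k) - s * s) * v $ 0 = 0" "((P - k) * (R - k) - s * s) * v $ 1 = 0"
      unfolding v(2,3) by (simp_all add: v(2,3))
    then show "(P - k) * (R - k) = s * s"
      using v(1) by auto
  next
    assume det: "(P - k) * (R - k) = s * s"
    \<comment> \<open>The vector (-s, P - k) solves the first row; when it is zero, the first basis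
      vector is an eigenvector.\<close>
    define v where "v = vec 2 (\<lambda>i. if P = k \<and> s = 0 then if i = 0 then 1 else 0 else if i = 0 then - s else P - k)"
    have v: "v \<in> carrier_vec 2"
      unfolding v_def by (rule vec_carrier)
    have coord: "v $ 0 = (if P = k \<and> s = 0 then 1 else - s)" "v $ 1 = (if P = k \<and> s = 0 then 0 else P - k)"
      by (simp_all add: v_def)
    have "v \<noteq> 0\<^sub>v 2"
      unfolding zero[OF v] coord by simp
    moreover have "s * - s + R * (P - k) = k * (P - k)"
      using det by (simp add: algebra_simps)
    then have "?K *\<^sub>v v = k \<cdot>\<^sub>v v"
      unfolding mult[OF v] coord by (simp add: algebra_simps)
    ultimately show "eigenvalue ?K k"
      using v unfolding eigenvalue_def eigenvector_def K by blast
  qed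
qed

lemma smult_mat_2x2:
  "z \<cdot>\<^sub>m mat_of_rows_list 2 [[P, s], [s', R]] = mat_of_rows_list 2 [[z * P, z * s], [z * s', z * R]]"
  by (rule eq_matI) (auto simp: mat_of_rows_list_def numeral_2_eq_2 less_Suc_eq)

text \<open>Subtracting the smaller eigenvalue leaves a form with diagonal
  \<open>A, B \<ge> 0\<close> and \<open>A * B = s\<^sup>2\<close>: semidefinite and degenerate. It
  vanishes at (-s, A), or at (1, 0) when \<open>A = 0\<close>.\<close>

lemma Min_eigenvalue_symmetric_2x2:
  fixes P R s \<mu> :: real
  assumes "\<mu> = Min {k. eigenvalue (mat_of_rows_list 2 [[P, s], [s, R]]) k}"
  shows "\<mu> * (\<alpha>\<^sup>2 + \<beta>\<^sup>2) \<le> P * \<alpha>\<^sup>2 + 2 * s * (\<alpha> * \<beta>) + R * \<beta>\<^sup>2"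
    and "\<exists>\<alpha> \<beta>. \<alpha>\<^sup>2 + \<beta>\<^sup>2 \<noteq> 0 \<and> P * \<alpha>\<^sup>2 + 2 * s * (\<alpha> * \<beta>) + R * \<beta>\<^sup>2 = \<mu> * (\<alpha>\<^sup>2 + \<beta>\<^sup>2)"
proof -
  define d where "d = sqrt ((P - R)\<^sup>2 + 4 * s\<^sup>2)"
  have d2: "d\<^sup>2 = (P - R)\<^sup>2 + 4 * s\<^sup>2" and d: "d \<ge> 0"
    by (simp_all add: d_def)
  have d_ge: "\<bar>P - R\<bar> \<le> d"
    by (rule abs_le_square_iff[THEN iffD2, of _ d, simplified abs_of_nonneg[OF d]]) (simp add: d2)
  have "(P - k) * (R - k) = s * s \<longleftrightarrow> (2 * k - P - R)\<^sup>2 = d\<^sup>2" for k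
    unfolding d2 by (simp add: power2_eq_square algebra_simps) argo
  moreover have "2 * k - P - R = d \<longleftrightarrow> k = (P + R + d) / 2" for k
    by (auto simp: field_simps)
  moreover have "2 * k - P - R = - d \<longleftrightarrow> k = (P + R - d) / 2" for k
    by (auto simp: field_simps)
  ultimately have "{k. eigenvalue (mat_of_rows_list 2 [[P, s], [s, R]]) k} = {(P + R + d) / 2, (P + R - d) / 2}"
    unfolding eigenvalue_symmetric_2x2 power2_eq_iff by blast
  then have \<mu>: "\<mu> = (P + R - d) / 2"
    using assms d by simp
  define A B where "A = P - \<mu>" and "B = R - \<mu>"
  have AB: "A \<ge> 0" "B \<ge> 0" "A * B = s\<^sup>2"
  proof -
    have AB: "A = (d + (P - R)) / 2" "B = (d - (P - R)) / 2"
      by (simp_all add: A_def B_def \<mu> field_simps)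
    then show "A \<ge> 0" "B \<ge> 0"
      using d_ge by simp_all
    have "A * B = (d\<^sup>2 - (P - R)\<^sup>2) / 4"
      by (simp add: AB power2_eq_square algebra_simps)
    then show "A * B = s\<^sup>2"
      by (simp add: d2)
  qed
  have form: "P * \<alpha>\<^sup>2 + 2 * s * (\<alpha> * \<beta>) + R * \<beta>\<^sup>2 - \<mu> * (\<alpha>\<^sup>2 + \<beta>\<^sup>2) = A * \<alpha>\<^sup>2 + 2 * s * (\<alpha> * \<beta>) + B * \<beta>\<^sup>2" for \<alpha> \<beta>
    by (simp add: A_def B_def algebra_simps)
  show "\<mu> * (\<alpha>\<^sup>2 + \<beta>\<^sup>2) \<le> P * \<alpha>\<^sup>2 + 2 * s * (\<alpha> * \<beta>) + R * \<beta>\<^sup>2"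
  proof (cases "A = 0")
    case True
    then have "s = 0" using AB(3) by simp
    moreover have "B * \<beta>\<^sup>2 \<ge> 0" using AB(2) by simp
    ultimately show ?thesis
      using form[of \<alpha> \<beta>] True by simp
  next
    case False
    have "A * (A * \<alpha>\<^sup>2 + 2 * s * (\<alpha> * \<beta>) + B * \<beta>\<^sup>2) = (A * \<alpha> + s * \<beta>)\<^sup>2 + (A * B - s\<^sup>2) * \<beta>\<^sup>2"
      by (simp add: power2_eq_square algebra_simps)
    then have "A * (A * \<alpha>\<^sup>2 + 2 * s * (\<alpha> * \<beta>) + B * \<beta>\<^sup>2) \<ge> 0"
      using AB by simp
    then have "A * \<alpha>\<^sup>2 + 2 * s * (\<alpha> * \<beta>) + B * \<beta>\<^sup>2 \<ge> 0"
      using False AB(1) by (simp add: zero_le_mult_iff)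
    then show ?thesis using form[of \<alpha> \<beta>] by simp
  qed
  show "\<exists>\<alpha> \<beta>. \<alpha>\<^sup>2 + \<beta>\<^sup>2 \<noteq> 0 \<and> P * \<alpha>\<^sup>2 + 2 * s * (\<alpha> * \<beta>) + R * \<beta>\<^sup>2 = \<mu> * (\<alpha>\<^sup>2 + \<beta>\<^sup>2)"
  proof (cases "A = 0")
    case True
    then show ?thesis using form[of 1 0] by (intro exI[of _ 1] exI[of _ 0]) simp
  next
    case False
    have "A * (- s)\<^sup>2 + 2 * s * (- s * A) + B * A\<^sup>2 = A * (A * B - s\<^sup>2)"
      by (simp add: power2_eq_square algebra_simps)
    then show ?thesis
      using False form[of "- s" A] AB(3) by (intro exI[of _ "- s"] exI[of _ A]) (simp add: add_nonneg_eq_0_iff)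
  qed
qed

section \<open>Extremal functions\<close>

context large_ternary_function begin

lemma exists_off_F3: "\<exists>w::'a. w \<notin> F3"
proof (rule ccontr)
  assume "\<not> ?thesis"
  then have "- F3 = {}" by auto
  then have "n = 0"
    using card_off_F3 by simp
  then show False using n_pos by simp
qed

lemma uminus_neq: "w \<noteq> 0 \<Longrightarrow> - w \<noteq> (w :: 'a)"
proof
  assume "w \<noteq> 0" "- w = w"
  have "w = w * 3 - (w - - w)" by simp
  also have "\<dots> = 0" using three \<open>- w = w\<close> by simp
  finally show False using \<open>w \<noteq> 0\<close> by simp
qed

definition "bump w r = (if r = w then 1 else 0 :: complex)" for w r :: 'a

lemma sum_bump: "sum (bump w) UNIV = 1"
  by (simp add: bump_def[abs_def])

lemma bump_uminus: "bump w (- r) = bump (- w) r"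
  by (auto simp: bump_def)

text \<open>An even function with zero sum meets only \<open>L1\<close>. Two different pairs of
  opposite units are needed to cancel the sum, which a point off the prime field provides.\<close>

lemma diagonal_attains_L1:
  "\<exists>D. D 0 = 0 \<and> (\<exists>r. D r \<noteq> 0) \<and> diagonal_energy F D = q * L1\<^sup>2 * sqnorm D"
proof -
  obtain w :: 'a where w: "w \<notin> F3"
    using exists_off_F3 by blast
  define D where "D r = (bump w r + bump (- w) r) - (bump 1 r + bump (- 1) r)" for r
  have "D 0 = 0"
    using w by (auto simp: D_def bump_def)
  have "D w \<noteq> 0"
    using w uminus_neq[of w] by (auto simp: D_def bump_def)
  have "evenp D = D" "oddp D = (\<lambda>r. 0)"
    by (auto simp: evenp_def oddp_def D_def bump_uminus)
  moreover have "sum D UNIV = 0"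
    by (simp add: D_def[abs_def] sum.distrib sum_subtractf sum_bump)
  ultimately have "diagonal_energy F D = q * L1\<^sup>2 * sqnorm D"
    using diagonal_energy_eq[of D, OF \<open>D 0 = 0\<close>] by simp
  with \<open>D 0 = 0\<close> \<open>D w \<noteq> 0\<close> show ?thesis by blast
qed

lemma diagonal_attains_L2:
  "\<exists>D. D 0 = 0 \<and> (\<exists>r. D r \<noteq> 0) \<and> diagonal_energy F D = q * L2\<^sup>2 * sqnorm D"
proof -
  define D where "D r = bump 1 r - bump (- 1) r" for r
  have "D 0 = 0" "D 1 \<noteq> 0"
    using distinct_F3 by (auto simp: D_def bump_def)
  have "evenp D = (\<lambda>r. 0)" "oddp D = D"
    by (auto simp: evenp_def oddp_def D_def bump_uminus)
  moreover have "sum D UNIV = 0"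
    by (simp add: D_def[abs_def] sum_subtractf sum_bump)
  ultimately have "diagonal_energy F D = q * L2\<^sup>2 * sqnorm D"
    using diagonal_energy_eq[of D, OF \<open>D 0 = 0\<close>] by simp
  with \<open>D 0 = 0\<close> \<open>D 1 \<noteq> 0\<close> show ?thesis by blast
qed

lemma avg_bump_diff:
  fixes w r :: 'a
  shows "avg (\<lambda>r. bump w r - bump (w + 1) r) r = 0"
proof -
  have shift: "r + 1 = w \<longleftrightarrow> r = w - 1" "r - 1 = w \<longleftrightarrow> r = w + 1"
    "r + 1 = w + 1 \<longleftrightarrow> r = w" "r - 1 = w + 1 \<longleftrightarrow> r = w + 2" for r :: 'a
    by (auto simp: algebra_simps)
  have "w + 2 = w - 1"
    by (simp add: two_eq)
  then show ?thesis
    unfolding avg_def bump_def shift by simp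
qed

text \<open>Vanishing coset averages remove \<open>L1\<close>, \<open>L2\<close> and the matrix part from the energy; the parity
  then selects \<open>L3\<close> (\<open>\<epsilon> = 1\<close>) or \<open>L4\<close> (\<open>\<epsilon> = - 1\<close>).\<close>

lemma coset_free_function:
  fixes \<epsilon> :: complex
  assumes "\<epsilon> = 1 \<or> \<epsilon> = - 1"
  obtains C where "C 0 = 0" "C 1 = 0" "C (- 1) = 0" "\<exists>r. C r \<noteq> 0"
    "\<And>r. C (- r) = \<epsilon> * C r" "avg C = (\<lambda>r. 0)" "sum C UNIV = 0"
proof -
  obtain w :: 'a where w: "w \<notin> F3"
    using exists_off_F3 by blast
  \<comment> \<open>Two points of one coset off the prime field cancel in the average. The reflected
    copy gives the parity, and it lies in a different coset, so the value at \<open>w\<close> stays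
    1.\<close>
  define g where "g r = bump w r - bump (w + 1) r" for r
  define C where "C r = g r + \<epsilon> * g (- r)" for r
  have w1: "w + 1 \<noteq> 0" "w + 1 \<noteq> 1" "w + 1 \<noteq> - 1" "- w \<noteq> w" "- w \<noteq> w + 1"
  proof -
    show "w + 1 \<noteq> 0" "w + 1 \<noteq> 1"
      using w by (auto simp: eq_neg_iff_add_eq_0)
    show "w + 1 \<noteq> - 1"
    proof
      assume "w + 1 = - 1"
      then have "w + (1 + 1) = 0" by (simp add: eq_neg_iff_add_eq_0 add.assoc)
      then have "w + - 1 = 0" by (simp add: two_eq)
      then show False using w by simp
    qed
    show "- w \<noteq> w"
      using w uminus_neq[of w] by simp
    show "- w \<noteq> w + 1"
    proof
      assume *: "- w = w + 1"
      have "w - 1 = 3 * w - (w + 1 - (- w))" by simp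
      also have "\<dots> = 0" unfolding three * by simp
      finally show False using w by simp
    qed
  qed
  have g: "g 0 = 0" "g 1 = 0" "g (- 1) = 0" "g w = 1" "g (- w) = 0"
    using w w1 by (auto simp: g_def bump_def)
  have "avg g r = 0" for r
    unfolding g_def by (rule avg_bump_diff)
  moreover have "avg (\<lambda>r. g (- r)) r = avg g (- r)" for r
  proof -
    have "- (r + 1) = - r - 1" "- (r - 1) = - r + 1" by simp_all
    then show ?thesis by (simp only: avg_def add_ac)
  qed
  ultimately have avg: "avg C = (\<lambda>r. 0)"
    unfolding C_def avg_add_cmult by simp
  then have sum: "sum C UNIV = 0"
    using sum_avg[of C] by simp
  have sym: "C (- r) = \<epsilon> * C r" for r
    using assms by (auto simp: C_def)
  have C: "C 0 = 0" "C 1 = 0" "C (- 1) = 0" "C w = 1"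
    by (simp_all add: C_def g)
  then have "\<exists>r. C r \<noteq> 0"
    by (intro exI[of _ w]) simp
  then show ?thesis
    by (rule that[OF C(1,2,3) _ sym avg sum])
qed

lemma sqnorm_off_F3:
  assumes "C 0 = 0" "C 1 = 0" "C (- 1) = 0"
  shows "(\<Sum>r\<in>- F3. (cmod (C r))\<^sup>2) = sqnorm C"
  using sum_F3[of "\<lambda>r. (cmod (C r))\<^sup>2"] assms by simp

lemma translate_attains_L3:
  "\<exists>C. C 1 = 0 \<and> C (- 1) = 0 \<and> (\<exists>r. C r \<noteq> 0) \<and> translate_energy F C = q * L3\<^sup>2 * sqnorm C"
proof -
  obtain C where C: "C 0 = 0" "C 1 = 0" "C (- 1) = 0" "\<exists>r. C r \<noteq> 0"
    and sym: "\<And>r. C (- r) = 1 * C r" and avg: "avg C = (\<lambda>r. 0)" "sum C UNIV = 0"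
    by (rule coset_free_function[of 1]) auto
  have "evenp C = C" "oddp C = (\<lambda>r. 0)"
    by (auto simp: evenp_def oddp_def sym)
  moreover have "avg (\<lambda>r. 0) = (\<lambda>r. 0)"
    by (simp add: avg_def[abs_def])
  ultimately have "translate_energy F C = q * L3\<^sup>2 * sqnorm C"
    unfolding translate_energy_eq[OF C(2,3)] by (simp add: avg C(1) sqnorm_off_F3[OF C(1,2,3)])
  with C show ?thesis by blast
qed

lemma translate_attains_L4:
  "\<exists>C. C 1 = 0 \<and> C (- 1) = 0 \<and> (\<exists>r. C r \<noteq> 0) \<and> translate_energy F C = q * L4\<^sup>2 * sqnorm C"
proof -
  obtain C where C: "C 0 = 0" "C 1 = 0" "C (- 1) = 0" "\<exists>r. C r \<noteq> 0"
    and sym: "\<And>r. C (- r) = - 1 * C r" and avg: "avg C = (\<lambda>r. 0)" "sum C UNIV = 0"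
    by (rule coset_free_function[of "- 1"]) auto
  have "evenp C = (\<lambda>r. 0)" "oddp C = C"
    by (auto simp: evenp_def oddp_def sym)
  moreover have "avg (\<lambda>r. 0) = (\<lambda>r. 0)"
    by (simp add: avg_def[abs_def])
  ultimately have "translate_energy F C = q * L4\<^sup>2 * sqnorm C"
    unfolding translate_energy_eq[OF C(2,3)] by (simp add: avg C(1))
  with C show ?thesis by blast
qed

text \<open>A function with value \<alpha> at 0 and constant off the prime field is even and has no
  remainder there, so only \<open>kform\<close> is left.\<close>

lemma translate_attains_kform:
  assumes "\<alpha>\<^sup>2 + \<beta>\<^sup>2 \<noteq> 0" and "kform \<alpha> \<beta> = \<theta> * (\<alpha>\<^sup>2 + \<beta>\<^sup>2)"
  shows "\<exists>C. C 1 = 0 \<and> C (- 1) = 0 \<and> (\<exists>r. C r \<noteq> 0) \<and> translate_energy F C = \<theta> * sqnorm C"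
proof -
  define C :: "'a \<Rightarrow> complex" where
    "C r = (if r = 0 then of_real \<alpha> else if r \<in> F3 then 0 else of_real (\<beta> / sqrt n))" for r
  have C: "C 1 = 0" "C (- 1) = 0" "C 0 = of_real \<alpha>"
    by (simp_all add: C_def)
  have off: "C r = of_real (\<beta> / sqrt n)" if "r \<in> - F3" for r
    using that by (auto simp: C_def)
  have avg_off: "avg C r = of_real (\<beta> / sqrt n)" if "r \<in> - F3" for r
  proof -
    have "r = s - 1" if "r + 1 = s" for s using that by (simp add: eq_diff_eq)
    \<comment> \<open>The complement of the prime field is a union of cosets, so a shift by 1 in
      either direction stays in it.\<close>
    then have up: "r + 1 \<in> - F3"
      using that minus_two_eq by fastforce
    have "r = s + 1" if "r - 1 = s" for s using that by (simp add: diff_eq_eq)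
    then have down: "r - 1 \<in> - F3"
      using that two_eq by fastforce
    show ?thesis
      unfolding avg_def off[OF that] off[OF up] off[OF down] by simp
  qed
  have "(cmod (of_real (\<beta> / sqrt n)))\<^sup>2 * n = \<beta>\<^sup>2"
    using n_pos by (simp add: norm_divide power_divide)
  then have norm_off: "(\<Sum>r\<in>- F3. (cmod (complex_of_real (\<beta> / sqrt n)))\<^sup>2) = \<beta>\<^sup>2"
    by (simp add: card_off_F3 mult.commute)
  have "sum C (- F3) = (\<Sum>r\<in>- F3. of_real (\<beta> / sqrt n))"
    by (intro sum.cong refl off)
  also have "\<dots> = of_real (n * (\<beta> / sqrt n))"
    by (simp only: sum_constant of_real_mult card_off_F3[symmetric] of_real_of_nat_eq)
  also have "n * (\<beta> / sqrt n) = sqrt n * \<beta>"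
    using n_pos by (simp add: field_simps)
  finally have sum: "sum C UNIV = of_real \<alpha> + of_real (sqrt n) * of_real \<beta>"
    unfolding sum_F3_complex C by simp
  have off_sum: "(\<Sum>r\<in>- F3. (cmod (C r))\<^sup>2) = \<beta>\<^sup>2" "(\<Sum>r\<in>- F3. (cmod (avg C r))\<^sup>2) = \<beta>\<^sup>2"
    "(\<Sum>r\<in>- F3. (cmod (C r - avg C r))\<^sup>2) = 0"
        unfolding norm_off[symmetric] by (intro sum.cong sum.neutral ballI refl; simp only: off avg_off; simp)+
  have norm: "sqnorm C = \<alpha>\<^sup>2 + \<beta>\<^sup>2"
    unfolding sum_F3 C off_sum by simp
  have "C (- r) = C r" for r
  proof -
    have "- r = 1 \<longleftrightarrow> r = - 1" by (metis minus_minus)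
    then show ?thesis by (auto simp: C_def)
  qed
  then have even: "evenp C = C" "oddp C = (\<lambda>r. 0)"
    by (auto simp: evenp_def oddp_def)
  have zero: "avg (\<lambda>r. 0) = (\<lambda>r. 0)"
    by (simp add: avg_def[abs_def])
  have "translate_energy F C = kform \<alpha> \<beta>"
    using kform_complex[OF sum]
    unfolding translate_energy_eq[OF C(1,2)] even zero off_sum sum C(3)
    by (simp add: kform_def[of 0 0])
  moreover have "\<exists>r. C r \<noteq> 0"
  proof (rule ccontr)
    assume "\<not> ?thesis"
    then have "sqnorm C = 0" by simp
    then show False using norm assms(1) by simp
  qed
  ultimately show ?thesis
    using C assms(2) norm by auto
qed

end

section \<open>The smallest singular value\<close>

text \<open>A lower bound that is attained determines \<open>LEAST\<close>; attainment also forces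
  \<open>T \<ge> 0\<close>, so the square root can be squared back.\<close>

lemma sigma_min_squared:
  fixes f \<psi>0 :: "'a::finite_field \<Rightarrow> complex"
  assumes lower: "\<And>A. T * (frobenius_norm_units A)\<^sup>2
      \<le> (\<Sum>g\<in>carrier affine_group. (cmod (measurement_map \<psi>0 f A g))\<^sup>2)"
    and attained: "frobenius_norm_units A0 \<noteq> 0"
      "(\<Sum>g\<in>carrier affine_group. (cmod (measurement_map \<psi>0 f A0 g))\<^sup>2) = T * (frobenius_norm_units A0)\<^sup>2"
  shows "(sigma_min \<psi>0 f)\<^sup>2 = T"
proof -
  have nonneg: "frobenius_norm_units A \<ge> 0" for A :: "'a \<Rightarrow> 'a \<Rightarrow> complex"
    by (simp add: frobenius_norm_units_def)
  have zero_iff: "frobenius_norm_units A = 0 \<longleftrightarrow> (\<forall>m m'. m \<noteq> 0 \<longrightarrow> m' \<noteq> 0 \<longrightarrow> A m m' = 0)" for A :: "'a \<Rightarrow> 'a \<Rightarrow> complex"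
    unfolding frobenius_norm_units_def by (subst L2_set_eq_0_iff) auto
  have "0 \<le> T * (frobenius_norm_units A0)\<^sup>2"
    unfolding attained(2)[symmetric] by (simp add: sum_nonneg)
  then have T: "T \<ge> 0"
    using attained(1) by (simp add: zero_le_mult_iff)
  have "sigma_min \<psi>0 f = sqrt T"
    unfolding sigma_min_def
  proof (rule Least_equality)
    have "L2_set (\<lambda>g. cmod (measurement_map \<psi>0 f A0 g)) (carrier affine_group) = sqrt T * frobenius_norm_units A0"
      unfolding L2_set_def attained(2) by (simp add: real_sqrt_mult nonneg)
    then show "\<exists>A. (\<exists>m m'. m \<noteq> 0 \<and> m' \<noteq> 0 \<and> A m m' \<noteq> 0) \<and>
        sqrt T = L2_set (\<lambda>g. cmod (measurement_map \<psi>0 f A g)) (carrier affine_group) / frobenius_norm_units A"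
      using attained(1) zero_iff[of A0] by (intro exI[of _ A0]) auto
  next
    fix r
    assume "\<exists>A. (\<exists>m m'. m \<noteq> 0 \<and> m' \<noteq> 0 \<and> A m m' \<noteq> 0) \<and>
        r = L2_set (\<lambda>g. cmod (measurement_map \<psi>0 f A g)) (carrier affine_group) / frobenius_norm_units A"
    then obtain A where A: "\<exists>m m'. m \<noteq> 0 \<and> m' \<noteq> 0 \<and> A m m' \<noteq> 0"
      and r: "r = L2_set (\<lambda>g. cmod (measurement_map \<psi>0 f A g)) (carrier affine_group) / frobenius_norm_units A"
      by blast
    have pos: "frobenius_norm_units A > 0"
      using A zero_iff[of A] nonneg[of A] by force
    have "sqrt T * frobenius_norm_units A = sqrt (T * (frobenius_norm_units A)\<^sup>2)"
      by (simp add: real_sqrt_mult nonneg)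
    also have "\<dots> \<le> L2_set (\<lambda>g. cmod (measurement_map \<psi>0 f A g)) (carrier affine_group)"
      unfolding L2_set_def using lower by (intro real_sqrt_le_mono)
    finally show "sqrt T \<le> r"
      unfolding r using pos by (simp add: field_simps)
  qed
  then show ?thesis using T by simp
qed

text \<open>The vector enters twice, once conjugated, so normalising by sqrt N divides values by N
  and the energy by N^2.\<close>

lemma measurement_map_divide:
  "measurement_map \<psi>0 (\<lambda>u. f u / of_real s) A g = measurement_map \<psi>0 f A g / of_real (s\<^sup>2)"
proof -
  obtain k l where g: "g = (k, l)" by force
  have "affine_rep \<psi>0 g (\<lambda>u. f u / of_real s) = (\<lambda>m. affine_rep \<psi>0 g f m / of_real s)"
    by (auto simp: affine_rep_def g)
  then show ?thesis
    by (simp add: measurement_map_def inner_units_def apply_units_def power2_eq_square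
        flip: sum_divide_distrib)
qed

context large_ternary_function begin

text \<open>A common bound \<theta> for all fibers bounds the whole energy because energy and norm
  split alike. Conversely, a matrix supported on one extremal fiber attains it.\<close>

lemma sigma_min_normalized:
  assumes \<psi>0: "nontrivial_additive_character \<psi>0" and N: "N > 0"
    and \<theta>: "\<theta> \<le> q * L1\<^sup>2" "\<theta> \<le> q * L2\<^sup>2" "\<theta> \<le> q * L3\<^sup>2" "\<theta> \<le> q * L4\<^sup>2"
    and form: "\<And>\<alpha> \<beta>. \<theta> * (\<alpha>\<^sup>2 + \<beta>\<^sup>2) \<le> kform \<alpha> \<beta>"
    and attained: "\<theta> = q * L1\<^sup>2 \<or> \<theta> = q * L2\<^sup>2 \<or> \<theta> = q * L3\<^sup>2 \<or> \<theta> = q * L4\<^sup>2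
      \<or> (\<exists>\<alpha> \<beta>. \<alpha>\<^sup>2 + \<beta>\<^sup>2 \<noteq> 0 \<and> kform \<alpha> \<beta> = \<theta> * (\<alpha>\<^sup>2 + \<beta>\<^sup>2))"
  shows "(sigma_min \<psi>0 (\<lambda>u. F u / of_real (sqrt N)))\<^sup>2 = q * (\<theta> / N\<^sup>2)"
proof -
  define energy where "energy A = diagonal_energy F (\<lambda>m. zero_extend A m m)
      + (\<Sum>d\<in>UNIV - {0}. translate_energy F (fiber A d))" for A :: "'a \<Rightarrow> 'a \<Rightarrow> complex"
  have map: "(\<Sum>g\<in>carrier affine_group. (cmod (measurement_map \<psi>0 (\<lambda>u. F u / of_real (sqrt N)) A g))\<^sup>2)
      = q * energy A / N\<^sup>2" for A
  proof -
    have "(sqrt N)\<^sup>2 = N" using N by simp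
    then show ?thesis
      using measurement_map_energy[OF \<psi>0 three, of F A]
      by (simp add: measurement_map_divide norm_divide power_divide energy_def card flip: sum_divide_distrib)
  qed
  note frob = frobenius_norm_fibers[OF three]
  have lower: "\<theta> * (frobenius_norm_units A)\<^sup>2 \<le> energy A" for A :: "'a \<Rightarrow> 'a \<Rightarrow> complex"
    unfolding frob energy_def distrib_left sum_distrib_left[of _ _ "UNIV - {0}"]
    by (intro add_mono sum_mono diagonal_energy_ge translate_energy_ge form \<theta>) (simp_all add: fiber_exclusions)
  have "\<exists>A. frobenius_norm_units A \<noteq> 0 \<and> energy A = \<theta> * (frobenius_norm_units A)\<^sup>2"
  proof -
    have sqnorm_nz: "sqnorm G \<noteq> 0" if "\<exists>r. G r \<noteq> 0" for G :: "'a \<Rightarrow> complex"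
      using that by (subst sum_nonneg_eq_0_iff) auto
    have zero_energy: "translate_energy F (\<lambda>r. 0) = 0" "diagonal_energy F (\<lambda>r. 0) = 0"
      by (simp_all add: translate_energy_def diagonal_energy_def)
    \<comment> \<open>\<open>L1\<close> and \<open>L2\<close> are attained on the diagonal;
      \<open>L3\<close>, \<open>L4\<close> and the matrix eigenvalue on a translate.\<close>
    have "(\<exists>D. D 0 = 0 \<and> (\<exists>r. D r \<noteq> 0) \<and> diagonal_energy F D = \<theta> * sqnorm D)
      \<or> (\<exists>C. C 1 = 0 \<and> C (- 1) = 0 \<and> (\<exists>r. C r \<noteq> 0) \<and> translate_energy F C = \<theta> * sqnorm C)"
      using attained
    proof (elim disjE exE conjE)
      assume "\<theta> = q * L1\<^sup>2"
      then show ?thesis by (intro disjI1) (simp only: diagonal_attains_L1)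
    next
      assume "\<theta> = q * L2\<^sup>2"
      then show ?thesis by (intro disjI1) (simp only: diagonal_attains_L2)
    next
      assume "\<theta> = q * L3\<^sup>2"
      then show ?thesis by (intro disjI2) (simp only: translate_attains_L3)
    next
      assume "\<theta> = q * L4\<^sup>2"
      then show ?thesis by (intro disjI2) (simp only: translate_attains_L4)
    next
      fix \<alpha> \<beta>
      assume "\<alpha>\<^sup>2 + \<beta>\<^sup>2 \<noteq> 0" "kform \<alpha> \<beta> = \<theta> * (\<alpha>\<^sup>2 + \<beta>\<^sup>2)"
      then show ?thesis by (intro disjI2 translate_attains_kform)
    qed
    then consider (diagonal) D where "D 0 = 0" "\<exists>r. D r \<noteq> 0" "diagonal_energy F D = \<theta> * sqnorm D"
      | (translate) C where "C 1 = 0" "C (- 1) = 0" "\<exists>r. C r \<noteq> 0" "translate_energy F C = \<theta> * sqnorm C"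
      by blast
    then show ?thesis
    proof cases
      case diagonal
      define A where "A = (\<lambda>m m'. if m = m' then D m else 0)"
      have "zero_extend A m m = D m" "d \<noteq> 0 \<Longrightarrow> fiber A d = (\<lambda>r. 0)" for m d
        using diagonal_matrix[of D, OF diagonal(1)] three by (auto simp: A_def)
      then have "(frobenius_norm_units A)\<^sup>2 = sqnorm D" "energy A = diagonal_energy F D"
        by (simp_all add: frob energy_def zero_energy)
      then show ?thesis
        using diagonal sqnorm_nz[of D] by (intro exI[of _ A]) auto
    next
      case translate
      define A where "A = (\<lambda>m m'. if m' = m + 1 then C (m - 1) else 0)"
      note tm = translate_matrix[of C, OF translate(1,2) three, folded A_def]
      have A: "zero_extend A m m = 0" "fiber A d = (if d = 1 then C else (\<lambda>r. 0))" for m d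
        using tm by auto
      have "(\<Sum>d\<in>UNIV - {0 :: 'a}. if d = 1 then t else 0) = t" for t :: real
        by simp
      then have "(frobenius_norm_units A)\<^sup>2 = sqnorm C" "energy A = translate_energy F C"
        unfolding frob energy_def A
        by (simp_all add: zero_energy if_distrib[of "translate_energy F"] if_distrib[of sqnorm] cong: if_cong)
      then show ?thesis
        using translate sqnorm_nz[of C] by (intro exI[of _ A]) auto
    qed
  qed
  then obtain A0 :: "'a \<Rightarrow> 'a \<Rightarrow> complex" where "frobenius_norm_units A0 \<noteq> 0" "energy A0 = \<theta> * (frobenius_norm_units A0)\<^sup>2"
    by blast
  moreover have "q * (\<theta> / N\<^sup>2) * (frobenius_norm_units A)\<^sup>2 \<le> q * energy A / N\<^sup>2" for A :: "'a \<Rightarrow> 'a \<Rightarrow> complex"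
    using mult_left_mono[OF lower[of A], of "q / N\<^sup>2"] q_pos by simp
  ultimately show ?thesis
    by (intro sigma_min_squared[of _ _ _ A0]) (simp_all add: map)
qed

end

theorem theorem6p10:
  fixes h q :: nat
    and a x y e b c n N Q V W Z L\<^sub>1 L\<^sub>2 L\<^sub>3 L\<^sub>4 \<mu> :: real
    and \<gamma> :: complex
    and \<psi> \<psi>0 F \<phi> :: "'a::finite_field \<Rightarrow> complex"
    and K :: "real mat"
  assumes "h \<ge> 2" and "q = 3 ^ h" and "CARD('a) = q"
    and "nontrivial_additive_character \<psi>0"
    and "\<psi> = trace_character h"
    and "\<gamma> = Complex x y"
    and "F = (\<lambda>u. of_real a + \<gamma> * \<psi> u + cnj \<gamma> * \<psi> (- u))"
    and "\<exists>u. F u \<noteq> 0"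
    and "e = x\<^sup>2 + y\<^sup>2" and "b = 2 * (x\<^sup>2 - y\<^sup>2)" and "c = 2 * a * x" and "n = real q - 3"
    and "N = real q * (a\<^sup>2 + 2 * e) - (a + 2 * x)\<^sup>2" and "Q = (a + 2 * x) ^ 4"
    and "V = (a\<^sup>2 + b)\<^sup>2 + 2 * (e + c)\<^sup>2" and "W = a ^ 4 + 2 * e\<^sup>2"
    and "Z = a\<^sup>2 * (a\<^sup>2 + b) + 2 * e * (e + c)"
    and "L\<^sub>1 = b + 2 * c" and "L\<^sub>2 = 4 * y * (x - a)"
    and "L\<^sub>3 = b - c" and "L\<^sub>4 = 2 * y * (2 * x + a)"
    and "\<phi> = (\<lambda>u. F u / of_real (sqrt N))"
    and "K = (1 / N\<^sup>2) \<cdot>\<^sub>m mat_of_rows_list 2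
               [[real q * V - Q, sqrt n * (real q * Z - Q)],
                [sqrt n * (real q * Z - Q), real q * (L\<^sub>1\<^sup>2 + n * W) - n * Q]]"
    and "\<mu> = Min {k. eigenvalue K k}"
  shows "L2_set (\<lambda>m. cmod (\<phi> m)) (UNIV - {0}) = 1 \<and>
         (sigma_min \<psi>0 \<phi>)\<^sup>2
           = real q * min (real q / N\<^sup>2 * Min {L\<^sub>1\<^sup>2, L\<^sub>2\<^sup>2, L\<^sub>3\<^sup>2, L\<^sub>4\<^sup>2}) \<mu>"
proof -
  have card: "CARD('a) = 3 ^ h"
    using assms(2,3) by simp
  have "(of_nat CHAR('a) :: 'a) = 0"
    by (rule of_nat_CHAR)
  then have three: "(3::'a) = 0"
    by (simp add: CHAR_eq_3[OF card])
  have "(3::nat) ^ 2 \<le> 3 ^ h"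
    using assms(1) by (intro power_increasing) auto
  then have "real q \<ge> 9"
    unfolding assms(2) using of_nat_le_iff[of 9 "3 ^ h", where ?'a = real] by simp
  \<comment> \<open>The trace enters through the nontriviality of its character, and
    \<open>h \<ge> 2\<close> through q >= 9.\<close>
  then interpret T: large_ternary_function \<psi> a x y "real q"
    using three assms(1,3) nontrivial_trace_character[OF card] by unfold_locales (auto simp: assms(5))
  have F: "F = T.F"
    by (rule ext) (simp only: assms(6,7) T.F_def)
  have N: "N = T.N" and n: "n = T.n"
    by (simp_all only: assms(9,12,13) T.N_def T.n_def T.p0_def)
  have L: "L\<^sub>1 = T.L1" "L\<^sub>2 = T.L2" "L\<^sub>3 = T.L3" "L\<^sub>4 = T.L4"
    by (simp_all add: assms(10,11,18-21) T.L1_def T.L2_def T.L3_def T.L4_def)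
  have N_pos: "N > 0"
    using assms(8) T.N_pos unfolding F N by blast
  have "(\<Sum>m\<in>UNIV - {0}. (cmod (\<phi> m))\<^sup>2) = 1"
    using N_pos T.sum_F_square
    by (simp add: assms(22) F[symmetric] N[symmetric] norm_divide power_divide flip: sum_divide_distrib)
  then have norm: "L2_set (\<lambda>m. cmod (\<phi> m)) (UNIV - {0}) = 1"
    by (simp add: L2_set_def)
  define P R s where "P = real q * V - Q" and "R = real q * (L\<^sub>1\<^sup>2 + n * W) - n * Q"
    and "s = sqrt n * (real q * Z - Q)"
  have kform: "T.kform \<alpha> \<beta> = P * \<alpha>\<^sup>2 + 2 * s * (\<alpha> * \<beta>) + R * \<beta>\<^sup>2" for \<alpha> \<beta>
    unfolding T.kform_eq[OF assms(9-11)] P_def R_def s_def assms(14-18) n ..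
  have \<mu>: "\<mu> = Min {k. eigenvalue (mat_of_rows_list 2 [[1 / N\<^sup>2 * P, 1 / N\<^sup>2 * s], [1 / N\<^sup>2 * s, 1 / N\<^sup>2 * R]]) k}"
    unfolding assms(24,23) smult_mat_2x2 P_def R_def s_def ..
  have scaled: "1 / N\<^sup>2 * P * \<alpha>\<^sup>2 + 2 * (1 / N\<^sup>2 * s) * (\<alpha> * \<beta>) + 1 / N\<^sup>2 * R * \<beta>\<^sup>2 = T.kform \<alpha> \<beta> / N\<^sup>2" for \<alpha> \<beta>
    unfolding kform by (simp add: add_divide_distrib)
  define M where "M = Min {L\<^sub>1\<^sup>2, L\<^sub>2\<^sup>2, L\<^sub>3\<^sup>2, L\<^sub>4\<^sup>2}"
  \<comment> \<open>The claimed minimum multiplied by \<open>N\<^sup>2\<close>, that is, the value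
    for the unnormalised \<open>F\<close>.\<close>
  define \<theta> where "\<theta> = min (real q * M) (N\<^sup>2 * \<mu>)"
  have "\<theta> / N\<^sup>2 = min (real q / N\<^sup>2 * M) \<mu>"
    using N_pos by (simp add: \<theta>_def min_divide_distrib_right)
  moreover have "(sigma_min \<psi>0 \<phi>)\<^sup>2 = real q * (\<theta> / N\<^sup>2)"
    unfolding assms(22) F N
  proof (rule T.sigma_min_normalized[OF assms(4)])
    show "T.N > 0" using N_pos N by simp
    have "\<theta> \<le> real q * M" by (simp add: \<theta>_def)
    moreover have "M \<le> L\<^sub>1\<^sup>2" "M \<le> L\<^sub>2\<^sup>2" "M \<le> L\<^sub>3\<^sup>2" "M \<le> L\<^sub>4\<^sup>2"
      by (simp_all add: M_def)
    ultimately show "\<theta> \<le> real q * T.L1\<^sup>2" "\<theta> \<le> real q * T.L2\<^sup>2" "\<theta> \<le> real q * T.L3\<^sup>2" "\<theta> \<le> real q * T.L4\<^sup>2"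
      unfolding L[symmetric] by (meson mult_left_mono of_nat_0_le_iff order_trans)+
    show "\<theta> * (\<alpha>\<^sup>2 + \<beta>\<^sup>2) \<le> T.kform \<alpha> \<beta>" for \<alpha> \<beta>
    proof -
      have "\<theta> * (\<alpha>\<^sup>2 + \<beta>\<^sup>2) \<le> N\<^sup>2 * \<mu> * (\<alpha>\<^sup>2 + \<beta>\<^sup>2)"
        by (intro mult_right_mono) (simp_all add: \<theta>_def)
      also have "\<dots> \<le> T.kform \<alpha> \<beta>"
        using Min_eigenvalue_symmetric_2x2(1)[OF \<mu>, of \<alpha> \<beta>] N_pos unfolding scaled by (simp add: field_simps)
      finally show ?thesis .
    qed
    have "M \<in> {L\<^sub>1\<^sup>2, L\<^sub>2\<^sup>2, L\<^sub>3\<^sup>2, L\<^sub>4\<^sup>2}"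
      unfolding M_def by (intro Min_in) auto
    moreover have "\<exists>\<alpha> \<beta>. \<alpha>\<^sup>2 + \<beta>\<^sup>2 \<noteq> 0 \<and> T.kform \<alpha> \<beta> = N\<^sup>2 * \<mu> * (\<alpha>\<^sup>2 + \<beta>\<^sup>2)"
      using Min_eigenvalue_symmetric_2x2(2)[OF \<mu>] N_pos unfolding scaled by (auto simp: field_simps)
    ultimately show "\<theta> = real q * T.L1\<^sup>2 \<or> \<theta> = real q * T.L2\<^sup>2 \<or> \<theta> = real q * T.L3\<^sup>2 \<or> \<theta> = real q * T.L4\<^sup>2
      \<or> (\<exists>\<alpha> \<beta>. \<alpha>\<^sup>2 + \<beta>\<^sup>2 \<noteq> 0 \<and> T.kform \<alpha> \<beta> = \<theta> * (\<alpha>\<^sup>2 + \<beta>\<^sup>2))"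
      unfolding \<theta>_def min_def L[symmetric] by auto
  qed
  ultimately show ?thesis
    using norm by (simp only: M_def)
qed

end
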